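(* Let $(\mathbf{C},\mathcal{M})$ be a (locally small) $\mathcal{M}$-category. Then $(\mathbf{C},\mathcal{M})$ is geometric, i.e. $\mathsf{Par}(\mathbf{C},\mathcal{M})$ is a join restriction category, if and only if the following hold: (1) for any family of $\mathcal{M}$-subobjects $\{m_i\colon A_i\to A\}_{i\in I}$ (of any object $A$), the colimit $\bigcup_{i\in I}A_i$ of its matching diagram exists; (2) the induced map $\bigvee_{i\in I}m_i\colon \bigcup_{i\in I}A_i\to A$ is in $\mathcal{M}$; and (3) the colimit $\bigcup_{i\in I}A_i$ from (1) is stable under pullback.
   Context: All categories are locally small; families are indexed by sets. Restriction categories. A restriction category is a category $\mathbf{X}$ with an assignment $f\mapsto \bar f$, $\mathbf{X}(A,B)\to\mathbf{X}(A,A)$, satisfying, for suitable maps, (R1) $f\bar f=f$; (R2) $\bar g\bar f=\bar f\bar g$; (R3) $\overline{g\bar f}=\bar g\bar f$; (R4) $\bar h f=f\,\overline{hf}$. Hom-sets are partially ordered by $f\le g$ iff $f=g\bar f$. Maps $f,g\in\mathbf{X}(A,B)$ are compatible if $f\bar g=g\bar f$; a set of parallel maps is compatible if its elements are pairwise compatible. A join restriction category is a restriction category in which every compatible set $S\subset\mathbf{X}(A,B)$ has a join $\bigvee_{s\in S}s$ with respect to the partial order on $\mathbf{X}(A,B)$, satisfying (J1) $\overline{\bigvee_{s\in S}s}=\bigvee_{s\in S}\bar s$ and (J2) $(\bigvee_{s\in S}s)\circ g=\bigvee_{s\in S}(s\circ g)$ for suitable $g$. $\mathcal{M}$-categories.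 An $\mathcal{M}$-category $(\mathbf{C},\mathcal{M})$ is a category $\mathbf{C}$ with a family $\mathcal{M}$ of monics containing all isomorphisms, closed under composition, and such that the pullback of any $m\in\mathcal{M}$ along any map exists and is in $\mathcal{M}$. An $\mathcal{M}$-subobject of $A$ is (an isomorphism class over $A$ of) a map $m\colon B\to A$ in $\mathcal{M}$. Locally small means $\mathbf{C}$ is locally small and the $\mathcal{M}$-subobjects of each object form a (small) partially ordered set. $\mathsf{Par}(\mathbf{C},\mathcal{M})$ is the category with the objects of $\mathbf{C}$, whose morphisms $A\to B$ are (isomorphism classes of) spans $(m,f)$ with $m\colon C\to A$ in $\mathcal{M}$ and $f\colon C\to B$, composed by pullback; it is a restriction category with $\overline{(m,f)}=(m,m)$. Matching diagram. For a family $\{m_i\colon A_i\to A\}_{i\in I}$ of $\mathcal{M}$-subobjects, let $A_iA_j$ be the pullback of $m_i$ and $m_j$, with projections $m_{ji}\colon A_iA_j\to A_i$ and $m_{ij}\colon A_iA_j\to A_j$. The matching diagram is the diagram in $\mathbf{C}$ on the objects $\{A_i\mid i\in I\}\cup\{A_iA_j\mid i\neq j\}$ with morphisms the $m_{ij}$. The $m_i$ form a cocone under it with vertex $A$, and $\bigvee_{i\in I} m_i$ denotes the map $\bigcup_{i\in I}A_i\to A$ induced by this cocone. Stability under pullback means that pulling back the colimit cocone $\{A_i\to\bigcup_{i\in I}A_i\}_{i\in I}$ (and the matching diagram) along any map into $\bigcup_{i\in I}A_i$ again gives a colimit cocone. *)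

theory Defs
  imports Main
begin

record ('o, 'a) cat =
  Obj :: "'o set"
  Arr :: "'a set"
  Dom :: "'a \<Rightarrow> 'o"
  Cod :: "'a \<Rightarrow> 'o"
  Ident :: "'o \<Rightarrow> 'a"
  Comp :: "'a \<Rightarrow> 'a \<Rightarrow> 'a"  (infixl "\<cdot>\<index>" 70)

definition hom :: "('o, 'a) cat \<Rightarrow> 'o \<Rightarrow> 'o \<Rightarrow> 'a set" where
  "hom C A B = {f \<in> Arr C. Dom C f = A \<and> Cod C f = B}"

locale category =
  fixes C :: "('o, 'a) cat" (structure)
  assumes Dom_Obj: "f \<in> Arr C \<Longrightarrow> Dom C f \<in> Obj C"
    and Cod_Obj: "f \<in> Arr C \<Longrightarrow> Cod C f \<in> Obj C"
    and Ident_hom: "A \<in> Obj C \<Longrightarrow> Ident C A \<in> hom C A A"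
    and Comp_hom: "\<lbrakk>f \<in> hom C A B; g \<in> hom C B D\<rbrakk> \<Longrightarrow> g \<cdot> f \<in> hom C A D"
    and Comp_Ident: "f \<in> hom C A B \<Longrightarrow> f \<cdot> Ident C A = f"
    and Ident_Comp: "f \<in> hom C A B \<Longrightarrow> Ident C B \<cdot> f = f"
    and Comp_assoc: "\<lbrakk>f \<in> hom C A B; g \<in> hom C B D; h \<in> hom C D E\<rbrakk>
      \<Longrightarrow> (h \<cdot> g) \<cdot> f = h \<cdot> (g \<cdot> f)"

definition monic :: "('o, 'a) cat \<Rightarrow> 'a \<Rightarrow> bool" where
  "monic C m \<longleftrightarrow> m \<in> Arr C \<and>
     (\<forall>B. \<forall>g \<in> hom C B (Dom C m). \<forall>h \<in> hom C B (Dom C m).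
        m \<cdot>\<^bsub>C\<^esub> g = m \<cdot>\<^bsub>C\<^esub> h \<longrightarrow> g = h)"

definition iso :: "('o, 'a) cat \<Rightarrow> 'a \<Rightarrow> bool" where
  "iso C i \<longleftrightarrow> i \<in> Arr C \<and>
     (\<exists>j \<in> hom C (Cod C i) (Dom C i).
        j \<cdot>\<^bsub>C\<^esub> i = Ident C (Dom C i) \<and> i \<cdot>\<^bsub>C\<^esub> j = Ident C (Cod C i))"

text \<open>The square \<open>f \<cdot> p = g \<cdot> q\<close> is a pullback; \<open>p\<close> is then the pullback of \<open>g\<close> along \<open>f\<close>.\<close>

definition pullback :: "('o, 'a) cat \<Rightarrow> 'a \<Rightarrow> 'a \<Rightarrow> 'a \<Rightarrow> 'a \<Rightarrow> bool" where
  "pullback C f g p q \<longleftrightarrow>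
     f \<in> Arr C \<and> g \<in> Arr C \<and> Cod C f = Cod C g \<and>
     p \<in> hom C (Dom C p) (Dom C f) \<and> q \<in> hom C (Dom C p) (Dom C g) \<and>
     f \<cdot>\<^bsub>C\<^esub> p = g \<cdot>\<^bsub>C\<^esub> q \<and>
     (\<forall>B. \<forall>r \<in> hom C B (Dom C f). \<forall>s \<in> hom C B (Dom C g).
        f \<cdot>\<^bsub>C\<^esub> r = g \<cdot>\<^bsub>C\<^esub> s \<longrightarrow>
        (\<exists>!u. u \<in> hom C B (Dom C p) \<and> p \<cdot>\<^bsub>C\<^esub> u = r \<and> q \<cdot>\<^bsub>C\<^esub> u = s))"

definition chosen_pullback :: "('o, 'a) cat \<Rightarrow> 'a \<Rightarrow> 'a \<Rightarrow> 'a \<times> 'a" where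
  "chosen_pullback C f g = (SOME (p, q). pullback C f g p q)"


text \<open>Restriction categories and joins\<close>

locale restriction_category = category C for C :: "('o, 'a) cat" (structure) +
  fixes R :: "'a \<Rightarrow> 'a"
  assumes R_hom: "f \<in> hom C A B \<Longrightarrow> R f \<in> hom C A A"
    and R1: "f \<in> hom C A B \<Longrightarrow> f \<cdot> R f = f"
    and R2: "\<lbrakk>f \<in> hom C A B; g \<in> hom C A D\<rbrakk> \<Longrightarrow> R g \<cdot> R f = R f \<cdot> R g"
    and R3: "\<lbrakk>f \<in> hom C A B; g \<in> hom C A D\<rbrakk> \<Longrightarrow> R (g \<cdot> R f) = R g \<cdot> R f"
    and R4: "\<lbrakk>f \<in> hom C A B; h \<in> hom C B D\<rbrakk> \<Longrightarrow> R h \<cdot> f = f \<cdot> R (h \<cdot> f)"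

definition restr_le :: "('o, 'a) cat \<Rightarrow> ('a \<Rightarrow> 'a) \<Rightarrow> 'a \<Rightarrow> 'a \<Rightarrow> bool" where
  "restr_le C R f g \<longleftrightarrow> f = g \<cdot>\<^bsub>C\<^esub> R f"

definition compatible :: "('o, 'a) cat \<Rightarrow> ('a \<Rightarrow> 'a) \<Rightarrow> 'a \<Rightarrow> 'a \<Rightarrow> bool" where
  "compatible C R f g \<longleftrightarrow> f \<cdot>\<^bsub>C\<^esub> R g = g \<cdot>\<^bsub>C\<^esub> R f"

definition compatible_set :: "('o, 'a) cat \<Rightarrow> ('a \<Rightarrow> 'a) \<Rightarrow> 'a set \<Rightarrow> bool" where
  "compatible_set C R S \<longleftrightarrow> (\<forall>f \<in> S. \<forall>g \<in> S. compatible C R f g)"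

definition is_join ::
    "('o, 'a) cat \<Rightarrow> ('a \<Rightarrow> 'a) \<Rightarrow> 'o \<Rightarrow> 'o \<Rightarrow> 'a set \<Rightarrow> 'a \<Rightarrow> bool" where
  "is_join C R A B S j \<longleftrightarrow> j \<in> hom C A B \<and> (\<forall>s \<in> S. restr_le C R s j) \<and>
     (\<forall>k \<in> hom C A B. (\<forall>s \<in> S. restr_le C R s k) \<longrightarrow> restr_le C R j k)"

text \<open>The objects \<open>A\<close> and \<open>B\<close> are explicit because the empty subset of each hom-set
  has a join as well. \<open>J1\<close> and \<open>J2\<close> say that the right-hand joins exist and have the
  stated value.\<close>

locale join_restriction_category = restriction_category C R
  for C :: "('o, 'a) cat" (structure) and R +
  assumes join_exists: "\<lbrakk>A \<in> Obj C; B \<in> Obj C; S \<subseteq> hom C A B; compatible_set C R S\<rbrakk>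
      \<Longrightarrow> \<exists>j. is_join C R A B S j"
    and J1: "\<lbrakk>S \<subseteq> hom C A B; compatible_set C R S; is_join C R A B S j\<rbrakk>
      \<Longrightarrow> is_join C R A A (R ` S) (R j)"
    and J2: "\<lbrakk>S \<subseteq> hom C A B; compatible_set C R S; is_join C R A B S j; g \<in> hom C D A\<rbrakk>
      \<Longrightarrow> is_join C R D B ((\<lambda>s. s \<cdot> g) ` S) (j \<cdot> g)"


text \<open>\<open>\<M>\<close>-categories\<close>

locale M_category = category C for C :: "('o, 'a) cat" (structure) +
  fixes M :: "'a set"
  assumes M_monic: "m \<in> M \<Longrightarrow> monic C m"
    and M_iso: "iso C i \<Longrightarrow> i \<in> M"
    and M_Comp: "\<lbrakk>m \<in> M; n \<in> M; Cod C n = Dom C m\<rbrakk> \<Longrightarrow> m \<cdot> n \<in> M"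
    and M_pullback: "\<lbrakk>m \<in> M; f \<in> Arr C; Cod C f = Cod C m\<rbrakk>
      \<Longrightarrow> \<exists>p q. pullback C f m p q \<and> p \<in> M"

definition subobject_class :: "('o, 'a) cat \<Rightarrow> 'a \<Rightarrow> 'a set" where
  "subobject_class C m = {m \<cdot>\<^bsub>C\<^esub> i | i. iso C i \<and> Cod C i = Dom C m}"

definition subobjects :: "('o, 'a) cat \<Rightarrow> 'a set \<Rightarrow> 'o \<Rightarrow> 'a set set" where
  "subobjects C M A = {subobject_class C m | m. m \<in> M \<and> Cod C m = A}"

text \<open>Smallness is relative to a type \<open>'i\<close>: a set is small if it is in bijection with some
  set of elements of \<open>'i\<close>. Small families are accordingly indexed by sets of
  elements of \<open>'i\<close>.\<close>

definition locally_small :: "'i itself \<Rightarrow> ('o, 'a) cat \<Rightarrow> 'a set \<Rightarrow> bool" where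
  "locally_small _ C M \<longleftrightarrow>
     (\<forall>A \<in> Obj C. \<forall>B \<in> Obj C. \<exists>e :: 'a \<Rightarrow> 'i. inj_on e (hom C A B)) \<and>
     (\<forall>A \<in> Obj C. \<exists>e :: 'a set \<Rightarrow> 'i. inj_on e (subobjects C M A))"

definition subobject_family ::
    "('o, 'a) cat \<Rightarrow> 'a set \<Rightarrow> 'o \<Rightarrow> 'i set \<Rightarrow> ('i \<Rightarrow> 'a) \<Rightarrow> bool" where
  "subobject_family C M A I m \<longleftrightarrow> A \<in> Obj C \<and> (\<forall>i \<in> I. m i \<in> M \<and> Cod C (m i) = A)"


text \<open>The category of partial maps: its arrows are isomorphism classes of spans\<close>

definition span_class :: "('o, 'a) cat \<Rightarrow> 'a \<Rightarrow> 'a \<Rightarrow> ('a \<times> 'a) set" where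
  "span_class C m f =
     {(m \<cdot>\<^bsub>C\<^esub> i, f \<cdot>\<^bsub>C\<^esub> i) | i. iso C i \<and> Cod C i = Dom C m}"

text \<open>Composites range over all representatives and all pullbacks; these all have the
  same isomorphism class, so the union is a single class.\<close>

definition par_comp ::
    "('o, 'a) cat \<Rightarrow> ('a \<times> 'a) set \<Rightarrow> ('a \<times> 'a) set \<Rightarrow> ('a \<times> 'a) set" where
  "par_comp C G F = \<Union> {span_class C (m \<cdot>\<^bsub>C\<^esub> p) (g \<cdot>\<^bsub>C\<^esub> q) | m f n g p q.
     (m, f) \<in> F \<and> (n, g) \<in> G \<and> pullback C f n p q}"

definition Par :: "('o, 'a) cat \<Rightarrow> 'a set \<Rightarrow> ('o, ('a \<times> 'a) set) cat" where
  "Par C M =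
     \<lparr>Obj = Obj C,
      Arr = {span_class C m f | m f. m \<in> M \<and> f \<in> Arr C \<and> Dom C m = Dom C f},
      Dom = (\<lambda>F. the_elem ((\<lambda>(m, f). Cod C m) ` F)),
      Cod = (\<lambda>F. the_elem ((\<lambda>(m, f). Cod C f) ` F)),
      Ident = (\<lambda>A. span_class C (Ident C A) (Ident C A)),
      Comp = par_comp C\<rparr>"

definition par_restriction :: "('o, 'a) cat \<Rightarrow> ('a \<times> 'a) set \<Rightarrow> ('a \<times> 'a) set" where
  "par_restriction C F = (\<Union>(m, f) \<in> F. span_class C m m)"

definition geometric :: "('o, 'a) cat \<Rightarrow> 'a set \<Rightarrow> bool" where
  "geometric C M \<longleftrightarrow> join_restriction_category (Par C M) (par_restriction C)"


text \<open>Diagrams on a graph, and their colimits\<close>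

record ('v, 'e, 'o, 'a) diagram =
  Vert :: "'v set"
  Edge :: "'e set"
  Src :: "'e \<Rightarrow> 'v"
  Tgt :: "'e \<Rightarrow> 'v"
  VObj :: "'v \<Rightarrow> 'o"
  EArr :: "'e \<Rightarrow> 'a"

definition cocone ::
    "('o, 'a) cat \<Rightarrow> ('v, 'e, 'o, 'a) diagram \<Rightarrow> 'o \<Rightarrow> ('v \<Rightarrow> 'a) \<Rightarrow> bool" where
  "cocone C D X c \<longleftrightarrow> X \<in> Obj C \<and> (\<forall>v \<in> Vert D. c v \<in> hom C (VObj D v) X) \<and>
     (\<forall>e \<in> Edge D. c (Tgt D e) \<cdot>\<^bsub>C\<^esub> EArr D e = c (Src D e))"

definition mediates :: "('o, 'a) cat \<Rightarrow> ('v, 'e, 'o, 'a) diagram \<Rightarrow>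
    'o \<Rightarrow> ('v \<Rightarrow> 'a) \<Rightarrow> 'o \<Rightarrow> ('v \<Rightarrow> 'a) \<Rightarrow> 'a \<Rightarrow> bool" where
  "mediates C D X c Y d u \<longleftrightarrow> u \<in> hom C X Y \<and> (\<forall>v \<in> Vert D. u \<cdot>\<^bsub>C\<^esub> c v = d v)"

definition colimit ::
    "('o, 'a) cat \<Rightarrow> ('v, 'e, 'o, 'a) diagram \<Rightarrow> 'o \<Rightarrow> ('v \<Rightarrow> 'a) \<Rightarrow> bool" where
  "colimit C D X c \<longleftrightarrow> cocone C D X c \<and>
     (\<forall>Y d. cocone C D Y d \<longrightarrow> (\<exists>!u. mediates C D X c Y d u))"

definition induced_map :: "('o, 'a) cat \<Rightarrow> ('v, 'e, 'o, 'a) diagram \<Rightarrow>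
    'o \<Rightarrow> ('v \<Rightarrow> 'a) \<Rightarrow> 'o \<Rightarrow> ('v \<Rightarrow> 'a) \<Rightarrow> 'a" where
  "induced_map C D X c Y d = (THE u. mediates C D X c Y d u)"

text \<open>Here \<open>p\<close> and \<open>q\<close> are projections of pullbacks of the legs of the cocone along \<open>f\<close>, and
  \<open>t\<close> consists of the maps that the edges of \<open>D\<close> induce between these pullbacks.\<close>

definition stable_under_pullback ::
    "('o, 'a) cat \<Rightarrow> ('v, 'e, 'o, 'a) diagram \<Rightarrow> 'o \<Rightarrow> ('v \<Rightarrow> 'a) \<Rightarrow> bool" where
  "stable_under_pullback C D X c \<longleftrightarrow> (\<forall>f \<in> Arr C. Cod C f = X \<longrightarrow>
     (\<forall>v \<in> Vert D. \<exists>p q. pullback C f (c v) p q) \<and>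
     (\<forall>p q t.
        (\<forall>v \<in> Vert D. pullback C f (c v) (p v) (q v)) \<and>
        (\<forall>e \<in> Edge D. t e \<in> hom C (Dom C (p (Src D e))) (Dom C (p (Tgt D e))) \<and>
           p (Tgt D e) \<cdot>\<^bsub>C\<^esub> t e = p (Src D e) \<and>
           q (Tgt D e) \<cdot>\<^bsub>C\<^esub> t e = EArr D e \<cdot>\<^bsub>C\<^esub> q (Src D e)) \<longrightarrow>
        colimit C (D\<lparr>VObj := \<lambda>v. Dom C (p v), EArr := t\<rparr>) (Dom C f) p))"


text \<open>The matching diagram\<close>

datatype 'i matching_vertex = Single 'i | Meet 'i 'i

datatype 'i matching_edge = Proj1 'i 'i | Proj2 'i 'i

text \<open>\<open>Meet i j\<close> is \<open>A\<^sub>iA\<^sub>j\<close>, with projections \<open>Proj1 i j\<close> to \<open>A\<^sub>i\<close> and \<open>Proj2 i j\<close> to \<open>A\<^sub>j\<close>.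
  Both \<open>Meet i j\<close> and \<open>Meet j i\<close> occur; they are canonically isomorphic and impose the
  same condition on a cocone.\<close>

definition matching_diagram :: "('o, 'a) cat \<Rightarrow> 'i set \<Rightarrow> ('i \<Rightarrow> 'a) \<Rightarrow>
    ('i matching_vertex, 'i matching_edge, 'o, 'a) diagram" where
  "matching_diagram C I m =
     \<lparr>Vert = {Single i | i. i \<in> I} \<union> {Meet i j | i j. i \<in> I \<and> j \<in> I \<and> i \<noteq> j},
      Edge = {Proj1 i j | i j. i \<in> I \<and> j \<in> I \<and> i \<noteq> j} \<union>
             {Proj2 i j | i j. i \<in> I \<and> j \<in> I \<and> i \<noteq> j},
      Src = (\<lambda>e. case e of Proj1 i j \<Rightarrow> Meet i j | Proj2 i j \<Rightarrow> Meet i j),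
      Tgt = (\<lambda>e. case e of Proj1 i j \<Rightarrow> Single i | Proj2 i j \<Rightarrow> Single j),
      VObj = (\<lambda>v. case v of Single i \<Rightarrow> Dom C (m i)
                | Meet i j \<Rightarrow> Dom C (fst (chosen_pullback C (m i) (m j)))),
      EArr = (\<lambda>e. case e of Proj1 i j \<Rightarrow> fst (chosen_pullback C (m i) (m j))
                | Proj2 i j \<Rightarrow> snd (chosen_pullback C (m i) (m j)))\<rparr>"

definition matching_cocone ::
    "('o, 'a) cat \<Rightarrow> ('i \<Rightarrow> 'a) \<Rightarrow> 'i matching_vertex \<Rightarrow> 'a" where
  "matching_cocone C m v = (case v of Single i \<Rightarrow> m i
     | Meet i j \<Rightarrow> m i \<cdot>\<^bsub>C\<^esub> fst (chosen_pullback C (m i) (m j)))"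

definition join_map :: "('o, 'a) cat \<Rightarrow> 'o \<Rightarrow> 'i set \<Rightarrow> ('i \<Rightarrow> 'a) \<Rightarrow>
    'o \<Rightarrow> ('i matching_vertex \<Rightarrow> 'a) \<Rightarrow> 'a" where
  "join_map C A I m U c =
     induced_map C (matching_diagram C I m) U c A (matching_cocone C m)"

end

theory Submission imports Defs begin

text \<open>A partial map \<open>(m, f)\<close> lies below \<open>(n, g)\<close> iff \<open>m = n u\<close> and \<open>f = g u\<close> for some \<open>u\<close>, and two
  partial maps are compatible iff they agree on the pullback of their domains. A compatible family
  \<open>(m\<^sub>i, f\<^sub>i)\<close> is thus a cocone under the matching diagram of the \<open>m\<^sub>i\<close>, and an upper bound of it
  is a subobject \<open>n\<close> through which all \<open>m\<^sub>i\<close> factor, with an extension of the cocone to it. If the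
  colimit \<open>U\<close> exists and \<open>U \<rightarrow> A\<close> is in \<open>\<M>\<close>, the join is the map induced on \<open>U\<close>; stability gives
  \<open>J2\<close>. Conversely, if joins exist, the join of the idempotents \<open>(m\<^sub>i, m\<^sub>i)\<close> is by \<open>J1\<close> an idempotent
  \<open>(n, n)\<close>, and joins of compatible families \<open>(m\<^sub>i, d\<^sub>i)\<close>, whose domain is again \<open>n\<close> by \<open>J1\<close>,
  provide the universal property of \<open>Dom n\<close> as a colimit. Applying \<open>J2\<close> to the total map
  \<open>(1, n f)\<close> shows that the join of the pulled back subobjects is the identity, so that the pulled
  back cocone is a colimit as well.\<close>

section \<open>Composition, isomorphisms and pullbacks in an arbitrary category\<close>

lemma homD:
  assumes "f \<in> hom C A B"
  shows "f \<in> Arr C" "Dom C f = A" "Cod C f = B"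
  using assms by (auto simp: hom_def)

context category
begin

lemma Arr_hom: "f \<in> Arr C \<Longrightarrow> f \<in> hom C (Dom C f) (Cod C f)"
  by (simp add: hom_def)

lemma comp_Arr [simp]:
  assumes "f \<in> Arr C" "g \<in> Arr C" "Cod C f = Dom C g"
  shows "g \<cdot> f \<in> Arr C" "Dom C (g \<cdot> f) = Dom C f" "Cod C (g \<cdot> f) = Cod C g"
  using Comp_hom[of f "Dom C f" "Dom C g" g "Cod C g"] assms by (auto simp: hom_def)

lemma Ident_Arr [simp]:
  assumes "A \<in> Obj C"
  shows "Ident C A \<in> Arr C" "Dom C (Ident C A) = A" "Cod C (Ident C A) = A"
  using Ident_hom[OF assms] by (auto simp: hom_def)

lemma comp_assoc [simp]:
  assumes "f \<in> Arr C" "g \<in> Arr C" "h \<in> Arr C" "Cod C f = Dom C g" "Cod C g = Dom C h"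
  shows "(h \<cdot> g) \<cdot> f = h \<cdot> (g \<cdot> f)"
  using Comp_assoc[of f "Dom C f" "Dom C g" g "Dom C h" h "Cod C h"] assms
  by (auto simp: hom_def)

lemma comp_Ident [simp]: "f \<in> Arr C \<Longrightarrow> Dom C f = A \<Longrightarrow> f \<cdot> Ident C A = f"
  using Comp_Ident[OF Arr_hom] by auto

lemma Ident_comp [simp]: "f \<in> Arr C \<Longrightarrow> Cod C f = A \<Longrightarrow> Ident C A \<cdot> f = f"
  using Ident_Comp[OF Arr_hom] by auto

declare Dom_Obj [simp] Cod_Obj [simp]

text \<open>\<open>comp_assoc\<close> as a simp rule nests composites to the right, which hides the
  left-hand side of a known equation. This lemma and \<open>comp_eq_right\<close> apply such
  equations below a further arrow \<open>x\<close>.\<close>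

lemma comp_cong_right:
  assumes "f \<cdot> p = g \<cdot> q" "f \<in> Arr C" "p \<in> Arr C" "g \<in> Arr C" "q \<in> Arr C" "x \<in> Arr C"
    "Cod C p = Dom C f" "Cod C q = Dom C g" "Cod C x = Dom C p" "Cod C x = Dom C q"
  shows "f \<cdot> (p \<cdot> x) = g \<cdot> (q \<cdot> x)"
  using arg_cong[OF assms(1), of "\<lambda>h. h \<cdot> x"] assms(2-) by simp

lemma comp_eq_right:
  assumes "f \<cdot> p = h" "f \<in> Arr C" "p \<in> Arr C" "x \<in> Arr C"
    "Cod C p = Dom C f" "Cod C x = Dom C p"
  shows "f \<cdot> (p \<cdot> x) = h \<cdot> x"
  using assms by (metis comp_assoc)

lemma monicD:
  assumes "monic C m" "m \<cdot> g = m \<cdot> h" "g \<in> Arr C" "h \<in> Arr C"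
    "Cod C g = Dom C m" "Cod C h = Dom C m" "Dom C g = Dom C h"
  shows "g = h"
  using assms unfolding monic_def hom_def by blast

lemma isoE:
  assumes "iso C i"
  obtains j where "i \<in> Arr C" "j \<in> Arr C" "Dom C j = Cod C i" "Cod C j = Dom C i"
    "j \<cdot> i = Ident C (Dom C i)" "i \<cdot> j = Ident C (Cod C i)" "iso C j"
proof -
  obtain j where j: "i \<in> Arr C" "j \<in> Arr C" "Dom C j = Cod C i" "Cod C j = Dom C i"
    "j \<cdot> i = Ident C (Dom C i)" "i \<cdot> j = Ident C (Cod C i)"
    using assms unfolding iso_def hom_def by auto
  then have "iso C j"
    unfolding iso_def hom_def by auto
  with j that show ?thesis by blast
qed

lemma isoI:
  assumes "i \<in> Arr C" "j \<in> Arr C" "Dom C j = Cod C i" "Cod C j = Dom C i"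
    "j \<cdot> i = Ident C (Dom C i)" "i \<cdot> j = Ident C (Cod C i)"
  shows "iso C i"
  using assms unfolding iso_def hom_def by auto

lemma iso_Arr: "iso C i \<Longrightarrow> i \<in> Arr C"
  by (simp add: iso_def)

lemma iso_Ident: "A \<in> Obj C \<Longrightarrow> iso C (Ident C A)"
  by (rule isoI[of _ "Ident C A"]) auto

lemma iso_comp:
  assumes "iso C i" "iso C k" "Cod C i = Dom C k"
  shows "iso C (k \<cdot> i)"
proof -
  obtain j where j: "i \<in> Arr C" "j \<in> Arr C" "Dom C j = Cod C i" "Cod C j = Dom C i"
    "j \<cdot> i = Ident C (Dom C i)" "i \<cdot> j = Ident C (Cod C i)"
    using assms(1) by (rule isoE)
  obtain l where l: "k \<in> Arr C" "l \<in> Arr C" "Dom C l = Cod C k" "Cod C l = Dom C k"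
    "l \<cdot> k = Ident C (Dom C k)" "k \<cdot> l = Ident C (Cod C k)"
    using assms(2) by (rule isoE)
  have "l \<cdot> (k \<cdot> i) = i" "i \<cdot> (j \<cdot> l) = l"
    using comp_eq_right[OF l(5), of i] comp_eq_right[OF j(6), of l] j l assms by auto
  then show ?thesis
    using j l assms by (intro isoI[of _ "j \<cdot> l"]) auto
qed

text \<open>The unique mediating arrow is split into existence and joint monicity of the
  projections, and membership in hom-sets into conditions on \<open>Dom\<close> and
  \<open>Cod\<close> that suit simp.\<close>

lemma pullbackI:
  assumes "f \<in> Arr C" "g \<in> Arr C" "p \<in> Arr C" "q \<in> Arr C"
    "Cod C f = Cod C g" "Cod C p = Dom C f" "Cod C q = Dom C g" "Dom C p = Dom C q"
    "f \<cdot> p = g \<cdot> q"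
    and ex: "\<And>r s. \<lbrakk>r \<in> Arr C; s \<in> Arr C; Dom C r = Dom C s; Cod C r = Dom C f;
        Cod C s = Dom C g; f \<cdot> r = g \<cdot> s\<rbrakk>
      \<Longrightarrow> \<exists>u. u \<in> Arr C \<and> Dom C u = Dom C s \<and> Cod C u = Dom C q \<and> p \<cdot> u = r \<and> q \<cdot> u = s"
    and un: "\<And>u v. \<lbrakk>u \<in> Arr C; v \<in> Arr C; Dom C u = Dom C v; Cod C u = Dom C q;
        Cod C v = Dom C q; p \<cdot> u = p \<cdot> v; q \<cdot> u = q \<cdot> v\<rbrakk> \<Longrightarrow> u = v"
  shows "pullback C f g p q"
  unfolding pullback_def
proof (intro conjI allI ballI impI)
  fix B r s
  assume rs: "r \<in> hom C B (Dom C f)" "s \<in> hom C B (Dom C g)" "f \<cdot> r = g \<cdot> s"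
  then obtain u where "u \<in> Arr C" "Dom C u = Dom C s" "Cod C u = Dom C q" "p \<cdot> u = r" "q \<cdot> u = s"
    using ex[of r s] unfolding hom_def by auto
  then show "\<exists>!u. u \<in> hom C B (Dom C p) \<and> p \<cdot> u = r \<and> q \<cdot> u = s"
    using rs assms(8) un by (intro ex1I[of _ u]) (auto simp: hom_def)
qed (use assms in \<open>auto simp: hom_def\<close>)

lemma pullbackD:
  assumes "pullback C f g p q"
  shows "f \<in> Arr C" "g \<in> Arr C" "p \<in> Arr C" "q \<in> Arr C"
    "Cod C g = Cod C f" "Cod C p = Dom C f" "Cod C q = Dom C g" "Dom C q = Dom C p"
    "f \<cdot> p = g \<cdot> q"
  using assms unfolding pullback_def hom_def by auto

lemma pullback_ex:
  assumes "pullback C f g p q" "r \<in> Arr C" "s \<in> Arr C" "Dom C r = Dom C s" "Cod C r = Dom C f"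
    "Cod C s = Dom C g" "f \<cdot> r = g \<cdot> s"
  obtains u where "u \<in> Arr C" "Dom C u = Dom C s" "Cod C u = Dom C p" "p \<cdot> u = r" "q \<cdot> u = s"
proof -
  have "r \<in> hom C (Dom C s) (Dom C f)" "s \<in> hom C (Dom C s) (Dom C g)"
    using assms by (simp_all add: hom_def)
  with assms(1,7) have "\<exists>!u. u \<in> hom C (Dom C s) (Dom C p) \<and> p \<cdot> u = r \<and> q \<cdot> u = s"
    unfolding pullback_def by blast
  then show ?thesis using that unfolding hom_def by auto
qed

lemma pullback_unique:
  assumes "pullback C f g p q" "u \<in> Arr C" "v \<in> Arr C" "Dom C u = Dom C v"
    "Cod C u = Dom C p" "Cod C v = Dom C p" "p \<cdot> u = p \<cdot> v" "q \<cdot> u = q \<cdot> v"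
  shows "u = v"
proof -
  note d = pullbackD[OF assms(1)]
  have "f \<cdot> (p \<cdot> u) = g \<cdot> (q \<cdot> u)"
    using comp_cong_right[OF d(9), of u] d assms(2,5) by simp
  moreover have "p \<cdot> u \<in> hom C (Dom C u) (Dom C f)" "q \<cdot> u \<in> hom C (Dom C u) (Dom C g)"
    using d assms(2,5) by (simp_all add: hom_def)
  ultimately
  have "\<exists>!w. w \<in> hom C (Dom C u) (Dom C p) \<and> p \<cdot> w = p \<cdot> u \<and> q \<cdot> w = q \<cdot> u"
    using assms(1) unfolding pullback_def by blast
  then show ?thesis using assms unfolding hom_def by auto
qed

lemma pullback_swap:
  assumes "pullback C f g p q"
  shows "pullback C g f q p"
proof -
  note d = pullbackD[OF assms]
  show ?thesis
  proof (rule pullbackI, goal_cases)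
    case (10 r s)
    then obtain u where "u \<in> Arr C" "Dom C u = Dom C r" "Cod C u = Dom C p"
      "p \<cdot> u = s" "q \<cdot> u = r"
      using pullback_ex[OF assms, of s r] by metis
    then show ?case using 10 d by (intro exI[of _ u]) auto
  next
    case (11 u v)
    show ?case by (rule pullback_unique[OF assms]) (use 11 d in auto)
  qed (use d in auto)
qed

lemma pullback_unique_iso:
  assumes "pullback C f g p q" "pullback C f g p' q'"
  obtains i where "iso C i" "Dom C i = Dom C p'" "Cod C i = Dom C p" "p' = p \<cdot> i" "q' = q \<cdot> i"
proof -
  note d = pullbackD[OF assms(1)] and d' = pullbackD[OF assms(2)]
  obtain i where i: "i \<in> Arr C" "Dom C i = Dom C q'" "Cod C i = Dom C p" "p \<cdot> i = p'" "q \<cdot> i = q'"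
    by (rule pullback_ex[OF assms(1), of p' q']) (use d d' in auto)
  obtain j where j: "j \<in> Arr C" "Dom C j = Dom C q" "Cod C j = Dom C p'" "p' \<cdot> j = p" "q' \<cdot> j = q"
    by (rule pullback_ex[OF assms(2), of p q]) (use d d' in auto)
  have "j \<cdot> i = Ident C (Dom C i)"
    by (rule pullback_unique[OF assms(2)])
      (use d d' i j comp_eq_right[OF j(4), of i] comp_eq_right[OF j(5), of i] in auto)
  moreover have "i \<cdot> j = Ident C (Cod C i)"
    by (rule pullback_unique[OF assms(1)])
      (use d d' i j comp_eq_right[OF i(4), of j] comp_eq_right[OF i(5), of j] in auto)
  ultimately have "iso C i"
    using i j d d' by (intro isoI[of _ j]) auto
  then show ?thesis using that i d' by auto
qed

text \<open>Pasting of two adjacent squares: the mediating arrow is built in two stages, first into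
  \<open>Dom C p\<close> and then into \<open>Dom C p'\<close>.\<close>

lemma pullback_paste:
  assumes "pullback C f g p q" "pullback C q c p' q'"
  shows "pullback C f (g \<cdot> c) (p \<cdot> p') q'"
proof -
  note d = pullbackD[OF assms(1)] and d' = pullbackD[OF assms(2)]
  show ?thesis
  proof (rule pullbackI, goal_cases)
    case 9
    show ?case using comp_cong_right[OF d(9), of p'] d d' by simp
  next
    case (10 r s)
    obtain u where u: "u \<in> Arr C" "Dom C u = Dom C (c \<cdot> s)" "Cod C u = Dom C p" "p \<cdot> u = r"
      "q \<cdot> u = c \<cdot> s"
      by (rule pullback_ex[OF assms(1), of r "c \<cdot> s"]) (use 10 d d' in auto)
    obtain v where v: "v \<in> Arr C" "Dom C v = Dom C s" "Cod C v = Dom C p'" "p' \<cdot> v = u"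
      "q' \<cdot> v = s"
      by (rule pullback_ex[OF assms(2), of u s]) (use 10 u d d' in auto)
    then show ?case using u d d' by (intro exI[of _ v]) auto
  next
    case (11 u v)
    have qq: "q \<cdot> (p' \<cdot> u) = q \<cdot> (p' \<cdot> v)"
      using 11 d d' comp_cong_right[OF d'(9), of u] comp_cong_right[OF d'(9), of v] by simp
    have pp: "p' \<cdot> u = p' \<cdot> v"
      by (rule pullback_unique[OF assms(1)]) (use qq 11 d d' in auto)
    show ?case
      by (rule pullback_unique[OF assms(2)]) (use pp 11 d d' in auto)
  qed (use d d' in auto)
qed

text \<open>Pulling \<open>n\<close> back along an arrow that already factors through it changes
  nothing, since the second leg is forced to be \<open>u \<cdot> r\<close> by monicity. Many
  composites of partial maps are computed from this trivial square.\<close>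

lemma pullback_along_factor:
  assumes "monic C n" "u \<in> Arr C" "Cod C u = Dom C n"
  shows "pullback C (n \<cdot> u) n (Ident C (Dom C u)) u"
proof -
  have n: "n \<in> Arr C" using assms(1) by (simp add: monic_def)
  show ?thesis
  proof (rule pullbackI, goal_cases)
    case (10 r s)
    have "u \<cdot> r = s"
      by (rule monicD[OF assms(1)]) (use 10 assms n in auto)
    then show ?case using 10 assms n by (intro exI[of _ r]) auto
  next
    case (11 u v)
    then show ?case using assms n by auto
  qed (use n assms in auto)
qed

text \<open>Cancelling \<open>n\<close> shows that both cospans have the same commuting squares,
  hence the same pullbacks.\<close>

lemma pullback_monic_comp:
  assumes "monic C n" "Cod C a = Dom C n" "Cod C b = Dom C n" "a \<in> Arr C" "b \<in> Arr C"
  shows "pullback C (n \<cdot> a) (n \<cdot> b) p q \<longleftrightarrow> pullback C a b p q"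
proof -
  have n: "n \<in> Arr C" using assms(1) by (simp add: monic_def)
  have eq: "n \<cdot> a \<cdot> x = n \<cdot> b \<cdot> y \<longleftrightarrow> a \<cdot> x = b \<cdot> y"
    if "x \<in> hom C X (Dom C a)" "y \<in> hom C X (Dom C b)" for x y X
  proof
    assume nn: "n \<cdot> a \<cdot> x = n \<cdot> b \<cdot> y"
    show "a \<cdot> x = b \<cdot> y"
      by (rule monicD[OF assms(1)]) (use nn that assms n in \<open>auto simp: hom_def\<close>)
  next
    assume "a \<cdot> x = b \<cdot> y"
    then show "n \<cdot> a \<cdot> x = n \<cdot> b \<cdot> y"
      using that assms n by (auto simp: hom_def)
  qed
  show ?thesis
    unfolding pullback_def using assms n eq by (simp cong: conj_cong)
qed

end

section \<open>Closure properties of the class \<open>M\<close>\<close>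

context M_category
begin

lemma M_Arr [simp]: "m \<in> M \<Longrightarrow> m \<in> Arr C"
  using M_monic by (simp add: monic_def)

lemma M_eq:
  assumes "m \<cdot> g = m \<cdot> h" "m \<in> M" "g \<in> Arr C" "h \<in> Arr C"
    "Cod C g = Dom C m" "Cod C h = Dom C m" "Dom C g = Dom C h"
  shows "g = h"
  using assms M_monic by (blast intro: monicD)

text \<open>The axiom only provides some pullback with a projection in \<open>M\<close>; any other
  one differs by an isomorphism, which lies in \<open>M\<close> too.\<close>

lemma M_pullback_closed:
  assumes "m \<in> M" "pullback C f m p q"
  shows "p \<in> M"
proof -
  note d = pullbackD[OF assms(2)]
  obtain p' q' where p': "pullback C f m p' q'" "p' \<in> M"
    using M_pullback[of m f] assms d by auto
  obtain i where "iso C i" "Cod C i = Dom C p'" "p = p' \<cdot> i"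
    using p'(1) assms(2) by (rule pullback_unique_iso)
  then show ?thesis using p' M_iso M_Comp by auto
qed

text \<open>Because \<open>m\<close> is monic, \<open>c\<close> is the pullback of
  \<open>m \<cdot> c\<close> along \<open>m\<close>.\<close>

lemma M_cancel:
  assumes "m \<cdot> c \<in> M" "m \<in> M" "c \<in> Arr C" "Cod C c = Dom C m"
  shows "c \<in> M"
proof -
  have "pullback C (m \<cdot> c) m (Ident C (Dom C c)) c"
    using assms M_monic by (intro pullback_along_factor) auto
  then show ?thesis
    using M_pullback_closed[OF assms(1) pullback_swap] by blast
qed

lemma pullback_obtain:
  assumes "m \<in> M" "f \<in> Arr C" "Cod C f = Cod C m"
  obtains p q where "pullback C f m p q" "p \<in> M"
  using M_pullback assms by blast

lemma chosen_pullback: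
  assumes "m \<in> M" "n \<in> M" "Cod C m = Cod C n"
  shows "pullback C m n (fst (chosen_pullback C m n)) (snd (chosen_pullback C m n))"
proof -
  obtain p q where "pullback C m n p q"
    using pullback_obtain[OF assms(2) M_Arr[OF assms(1)] assms(3)] by blast
  then have "\<exists>x. (\<lambda>(p, q). pullback C m n p q) x" by auto
  from someI_ex[OF this] show ?thesis
    unfolding chosen_pullback_def by (simp add: case_prod_unfold)
qed

subsection \<open>Partial maps\<close>

text \<open>Pasting with the trivial pullback square of the inverse \<open>j\<close> turns the leg
  into \<open>(f \<cdot> i) \<cdot> j = f\<close>. Used to change representatives of spans inside a
  composite.\<close>

lemma pullback_iso_leg:
  assumes "pullback C n (f \<cdot> i) q p" "iso C i" "f \<in> Arr C" "Cod C i = Dom C f"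
  shows "pullback C n f q (i \<cdot> p)"
proof -
  note d = pullbackD[OF assms(1)]
  obtain j where j: "i \<in> Arr C" "j \<in> Arr C" "Dom C j = Cod C i" "Cod C j = Dom C i"
    "j \<cdot> i = Ident C (Dom C i)" "i \<cdot> j = Ident C (Cod C i)" "iso C j"
    using assms(2) by (rule isoE)
  have Cod: "Cod C p = Dom C i" using d j assms by simp
  have "j \<cdot> (i \<cdot> p) = p"
    using comp_eq_right[OF j(5), of p] Cod d j by simp
  moreover have "pullback C (j \<cdot> (i \<cdot> p)) j (Ident C (Dom C (i \<cdot> p))) (i \<cdot> p)"
    by (rule pullback_along_factor) (use M_monic[OF M_iso[OF j(7)]] Cod j d in auto)
  ultimately have "pullback C n ((f \<cdot> i) \<cdot> j) (q \<cdot> Ident C (Dom C (i \<cdot> p))) (i \<cdot> p)"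
    using pullback_paste[OF assms(1)] by simp
  moreover have "(f \<cdot> i) \<cdot> j = f" "q \<cdot> Ident C (Dom C (i \<cdot> p)) = q"
    using j assms d Cod by simp_all
  ultimately show ?thesis by simp
qed

abbreviation span :: "'a \<Rightarrow> 'a \<Rightarrow> ('a \<times> 'a) set" where
  "span \<equiv> span_class C"

abbreviation P where "P \<equiv> Par C M"

abbreviation R :: "('a \<times> 'a) set \<Rightarrow> ('a \<times> 'a) set" where
  "R \<equiv> par_restriction C"

definition partial_map :: "'o \<Rightarrow> 'o \<Rightarrow> 'a \<Rightarrow> 'a \<Rightarrow> bool" where
  "partial_map A B m f \<longleftrightarrow> m \<in> M \<and> f \<in> Arr C \<and> Dom C m = Dom C f \<and> Cod C m = A \<and> Cod C f = B"

lemma partial_mapI: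
  "\<lbrakk>m \<in> M; f \<in> Arr C; Dom C m = Dom C f; Cod C m = A; Cod C f = B\<rbrakk> \<Longrightarrow> partial_map A B m f"
  by (simp add: partial_map_def)

lemma partial_mapD:
  assumes "partial_map A B m f"
  shows "m \<in> M" "m \<in> Arr C" "f \<in> Arr C" "Dom C f = Dom C m" "Cod C m = A" "Cod C f = B"
    "A \<in> Obj C" "B \<in> Obj C"
  using assms by (auto simp: partial_map_def)

lemma span_iff:
  assumes "partial_map A B m f"
  shows "(m', f') \<in> span m f \<longleftrightarrow> (\<exists>i. iso C i \<and> Cod C i = Dom C m \<and> m' = m \<cdot> i \<and> f' = f \<cdot> i)"
  by (auto simp: span_class_def)

lemma span_self:
  assumes "partial_map A B m f"
  shows "(m, f) \<in> span m f"
  using partial_mapD[OF assms] by (auto simp: span_class_def intro!: exI[of _ "Ident C (Dom C m)"] iso_Ident)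

text \<open>Isomorphisms compose and invert, so every member of a class generates that class and may
  serve as its representative.\<close>

lemma span_member:
  assumes "partial_map A B m f" "(m', f') \<in> span m f"
  shows "partial_map A B m' f'" "span m' f' = span m f"
proof -
  note d = partial_mapD[OF assms(1)]
  obtain i where i: "iso C i" "Cod C i = Dom C m" "m' = m \<cdot> i" "f' = f \<cdot> i"
    using assms span_iff by auto
  obtain j where j: "i \<in> Arr C" "j \<in> Arr C" "Dom C j = Cod C i" "Cod C j = Dom C i"
    "j \<cdot> i = Ident C (Dom C i)" "i \<cdot> j = Ident C (Cod C i)" "iso C j"
    using i(1) by (rule isoE)
  show pm: "partial_map A B m' f'"
    using i j d M_Comp[OF d(1) M_iso[OF i(1)]] by (intro partial_mapI) auto
  show "span m' f' = span m f"
  proof (intro equalityI subsetI)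
    fix x assume "x \<in> span m' f'"
    then obtain k where k: "iso C k" "Cod C k = Dom C m'" "x = (m' \<cdot> k, f' \<cdot> k)"
      by (auto simp: span_class_def)
    have "iso C (i \<cdot> k)" using k i j d by (intro iso_comp) auto
    then show "x \<in> span m f"
      using i j d k iso_Arr[OF k(1)] by (auto simp: span_class_def intro!: exI[of _ "i \<cdot> k"])
  next
    fix x assume "x \<in> span m f"
    then obtain k where k: "iso C k" "Cod C k = Dom C m" "x = (m \<cdot> k, f \<cdot> k)"
      by (auto simp: span_class_def)
    have kA: "k \<in> Arr C" using k(1) by (rule iso_Arr)
    have "iso C (j \<cdot> k)" using k i j d by (intro iso_comp) auto
    moreover have "i \<cdot> (j \<cdot> k) = k"
      using comp_eq_right[OF j(6), of k] k kA i j d by simp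
    ultimately show "x \<in> span m' f'"
      using i j d k kA by (auto simp: span_class_def intro!: exI[of _ "j \<cdot> k"])
  qed
qed

lemma span_eq_iff:
  assumes "partial_map A B m f" "partial_map A B m' f'"
  shows "span m' f' = span m f \<longleftrightarrow>
    (\<exists>i. iso C i \<and> Cod C i = Dom C m \<and> m' = m \<cdot> i \<and> f' = f \<cdot> i)"
  using span_iff[OF assms(1)] span_member[OF assms(1)] span_self[OF assms(2)] by metis

lemma Par_sel [simp]:
  "Obj P = Obj C"
  "Arr P = {span m f | m f. m \<in> M \<and> f \<in> Arr C \<and> Dom C m = Dom C f}"
  "Ident P A = span (Ident C A) (Ident C A)"
  "Comp P = par_comp C"
  by (simp_all add: Par_def)

text \<open>\<open>Dom\<close> and \<open>Cod\<close> of \<open>Par\<close> are read off with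
  \<open>the_elem\<close>; this is meaningful because precomposition with isomorphisms leaves the
  codomains of both legs unchanged.\<close>

lemma Par_Dom_Cod:
  assumes "partial_map A B m f"
  shows "Dom P (span m f) = A" "Cod P (span m f) = B"
proof -
  have "(\<lambda>(m, f). Cod C m) ` span m f = {A}" "(\<lambda>(m, f). Cod C f) ` span m f = {B}"
    using span_self[OF assms] span_member(1)[OF assms]
    by (force simp: partial_map_def)+
  then show "Dom P (span m f) = A" "Cod P (span m f) = B"
    by (simp_all add: Par_def)
qed

lemma span_hom: "partial_map A B m f \<Longrightarrow> span m f \<in> hom P A B"
  using Par_Dom_Cod[of A B m f] by (auto simp: hom_def partial_map_def)

lemma Par_homE:
  assumes "F \<in> hom P A B"
  obtains m f where "partial_map A B m f" "F = span m f"
proof -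
  obtain m f where mf: "F = span m f" "m \<in> M" "f \<in> Arr C" "Dom C m = Dom C f"
    using assms by (auto simp: hom_def)
  then have pm: "partial_map (Cod C m) (Cod C f) m f"
    by (simp add: partial_map_def)
  then have "Cod C m = A" "Cod C f = B"
    using assms mf Par_Dom_Cod[OF pm] by (auto simp: hom_def)
  with pm mf that show ?thesis by blast
qed

lemma partial_map_comp:
  assumes "partial_map A B m f" "partial_map B D n g" "pullback C f n p q"
  shows "partial_map A D (m \<cdot> p) (g \<cdot> q)"
proof -
  note d = partial_mapD[OF assms(1)] partial_mapD[OF assms(2)] pullbackD[OF assms(3)]
  have "p \<in> M" using M_pullback_closed[OF d(9) assms(3)] .
  then show ?thesis using d by (intro partial_mapI M_Comp) auto
qed

text \<open>\<open>par_comp\<close> is a union over all representatives and all pullbacks. Every one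
  of them contributes the same class, so a composite may be computed from a single choice.\<close>

lemma par_comp_span:
  assumes "partial_map A B m f" "partial_map B D n g" "pullback C f n p q"
  shows "par_comp C (span n g) (span m f) = span (m \<cdot> p) (g \<cdot> q)"
proof -
  note pm = partial_map_comp[OF assms]
  have "span (m' \<cdot> p') (g' \<cdot> q') = span (m \<cdot> p) (g \<cdot> q)"
    if mem: "(m', f') \<in> span m f" "(n', g') \<in> span n g" "pullback C f' n' p' q'" for m' f' n' g' p' q'
  proof -
    note d = partial_mapD[OF assms(1)] and e = partial_mapD[OF assms(2)] and h = pullbackD[OF mem(3)]
    have pm': "partial_map A D (m' \<cdot> p') (g' \<cdot> q')"
      using partial_map_comp span_member(1) assms(1,2) mem by blast
    obtain i where i: "iso C i" "Cod C i = Dom C m" "m' = m \<cdot> i" "f' = f \<cdot> i"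
      using mem(1) by (auto simp: span_class_def)
    obtain k where k: "iso C k" "Cod C k = Dom C n" "n' = n \<cdot> k" "g' = g \<cdot> k"
      using mem(2) by (auto simp: span_class_def)
    \<comment> \<open>The isomorphisms \<open>i\<close> and \<open>k\<close> relating the
      representatives are moved into the projections one after the other. What results is a second
      pullback of \<open>f\<close> and \<open>n\<close>, hence isomorphic to \<open>p\<close>,
      \<open>q\<close>.\<close>
    have "pullback C n' (f \<cdot> i) q' p'"
      using pullback_swap[OF mem(3)] i by simp
    then have "pullback C n' f q' (i \<cdot> p')"
      by (rule pullback_iso_leg) (use i d in simp_all)
    then have "pullback C f (n \<cdot> k) (i \<cdot> p') q'"
      using pullback_swap k by simp
    then have "pullback C f n (i \<cdot> p') (k \<cdot> q')"
      by (rule pullback_iso_leg) (use k e in simp_all)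
    then obtain x where x: "iso C x" "Dom C x = Dom C (i \<cdot> p')" "Cod C x = Dom C p"
      "i \<cdot> p' = p \<cdot> x" "k \<cdot> q' = q \<cdot> x"
      using pullback_unique_iso[OF assms(3)] by metis
    have "m' \<cdot> p' = (m \<cdot> p) \<cdot> x" "g' \<cdot> q' = (g \<cdot> q) \<cdot> x"
      using x iso_Arr[OF x(1)] h i k iso_Arr[OF i(1)] iso_Arr[OF k(1)] d e pullbackD[OF assms(3)] by auto
    then show ?thesis
      unfolding span_eq_iff[OF pm pm'] using x pullbackD[OF assms(3)] d e by auto
  qed
  moreover have "(m, f) \<in> span m f" "(n, g) \<in> span n g"
    using span_self assms by auto
  ultimately have "{span (m' \<cdot> p) (g' \<cdot> q) | m' f' n' g' p q.
      (m', f') \<in> span m f \<and> (n', g') \<in> span n g \<and> pullback C f' n' p q}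
      = {span (m \<cdot> p) (g \<cdot> q)}"
    using assms(3) by blast
  then show ?thesis unfolding par_comp_def by simp
qed

lemma par_restriction_span:
  assumes "partial_map A B m f"
  shows "R (span m f) = span m m"
proof -
  note d = partial_mapD[OF assms]
  have pm: "partial_map A A m m" using d by (intro partial_mapI) auto
  have "span m' m' = span m m" if "(m', f') \<in> span m f" for m' f'
    using that span_iff[OF assms] span_iff[OF pm] span_member(2)[OF pm] by metis
  then show ?thesis
    unfolding par_restriction_def using span_self[OF assms] by blast
qed

lemma partial_map_restriction: "partial_map A B m f \<Longrightarrow> partial_map A A m m"
  by (auto simp: partial_map_def)

lemma Par_comp_obtain:
  assumes "partial_map A B m f" "partial_map B D n g"
  obtains p q where "pullback C f n p q" "partial_map A D (m \<cdot> p) (g \<cdot> q)"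
    "par_comp C (span n g) (span m f) = span (m \<cdot> p) (g \<cdot> q)"
proof -
  obtain p q where "pullback C f n p q"
    using pullback_obtain[of n f] partial_mapD[OF assms(1)] partial_mapD[OF assms(2)] by metis
  with that partial_map_comp[OF assms] par_comp_span[OF assms] show ?thesis by blast
qed

lemma pullback_Ident:
  assumes "f \<in> Arr C" "Cod C f = B"
  shows "pullback C f (Ident C B) (Ident C (Dom C f)) f"
  using pullback_along_factor[of "Ident C B" f] assms M_monic[OF M_iso[OF iso_Ident]]
  by auto

lemma pullback_self: "m \<in> M \<Longrightarrow> pullback C m m (Ident C (Dom C m)) (Ident C (Dom C m))"
  using pullback_along_factor[of m "Ident C (Dom C m)"] M_monic by auto

lemma partial_map_Ident: "A \<in> Obj C \<Longrightarrow> partial_map A A (Ident C A) (Ident C A)"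
  by (auto simp: partial_map_def intro: M_iso iso_Ident)

lemma partial_map_total: "f \<in> hom C A B \<Longrightarrow> partial_map A B (Ident C A) f"
  using Dom_Obj[of f] by (auto simp: partial_map_def hom_def intro!: M_iso iso_Ident)

text \<open>Composition with the idempotent of \<open>m\<close> restricts \<open>(n, g)\<close> to
  the intersection of the two domains of definition.\<close>

lemma span_comp_restriction:
  assumes "partial_map A B m f" "partial_map A D n g" "pullback C m n p q"
  shows "par_comp C (span n g) (span m m) = span (m \<cdot> p) (g \<cdot> q)"
    "partial_map A D (m \<cdot> p) (g \<cdot> q)"
  using par_comp_span[OF partial_map_restriction] partial_map_comp[OF partial_map_restriction] assms
  by blast+

section \<open>Partial maps form a restriction category\<close>

lemma Par_category: "category P"
proof
  fix f assume "f \<in> Arr P"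
  then have "f \<in> hom P (Dom P f) (Cod P f)" by (simp add: hom_def)
  then show "Dom P f \<in> Obj P" "Cod P f \<in> Obj P"
    by (metis Par_homE Par_sel(1) partial_mapD(7,8))+
next
  fix A assume "A \<in> Obj P"
  then show "Ident P A \<in> hom P A A"
    using span_hom[OF partial_map_Ident] by simp
next
  fix F G A B D assume FG: "F \<in> hom P A B" "G \<in> hom P B D"
  obtain m f where mf: "partial_map A B m f" "F = span m f"
    using FG(1) by (rule Par_homE)
  obtain n g where ng: "partial_map B D n g" "G = span n g"
    using FG(2) by (rule Par_homE)
  show "G \<cdot>\<^bsub>P\<^esub> F \<in> hom P A D"
    by (rule Par_comp_obtain[OF mf(1) ng(1)]) (metis Par_sel(4) span_hom mf(2) ng(2))
next
  fix F A B assume F: "F \<in> hom P A B"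
  obtain m f where mf: "partial_map A B m f" "F = span m f"
    using F by (rule Par_homE)
  note d = partial_mapD[OF mf(1)]
  show "F \<cdot>\<^bsub>P\<^esub> Ident P A = F"
    using par_comp_span[OF partial_map_Ident mf(1) pullback_swap[OF pullback_Ident]] mf d by simp
  show "Ident P B \<cdot>\<^bsub>P\<^esub> F = F"
    using par_comp_span[OF mf(1) partial_map_Ident pullback_Ident] mf d by simp
next
  fix F G H A B D E assume FGH: "F \<in> hom P A B" "G \<in> hom P B D" "H \<in> hom P D E"
  obtain m f where mf: "partial_map A B m f" "F = span m f"
    using FGH(1) by (rule Par_homE)
  obtain n g where ng: "partial_map B D n g" "G = span n g"
    using FGH(2) by (rule Par_homE)
  obtain l h where lh: "partial_map D E l h" "H = span l h"
    using FGH(3) by (rule Par_homE)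
  note d = partial_mapD[OF mf(1)] partial_mapD[OF ng(1)] partial_mapD[OF lh(1)]
  obtain p q where pq: "pullback C f n p q" "partial_map A D (m \<cdot> p) (g \<cdot> q)"
    "par_comp C (span n g) (span m f) = span (m \<cdot> p) (g \<cdot> q)"
    using mf(1) ng(1) by (rule Par_comp_obtain)
  obtain r s where rs: "pullback C g l r s" "partial_map B E (n \<cdot> r) (h \<cdot> s)"
    "par_comp C (span l h) (span n g) = span (n \<cdot> r) (h \<cdot> s)"
    using ng(1) lh(1) by (rule Par_comp_obtain)
  note dp = pullbackD[OF pq(1)] and dr = pullbackD[OF rs(1)]
  have "Cod C q = Cod C r" using dp dr d by simp
  \<comment> \<open>Both bracketings are computed over this one pullback, pasted onto the square of
    \<open>r\<close>, \<open>s\<close> for one and onto the square of \<open>p\<close>,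
    \<open>q\<close> for the other.\<close>
  then obtain x y where xy: "pullback C q r x y"
    using pullback_obtain[of r q] M_pullback_closed[OF d(17) rs(1)] dp by metis
  note dx = pullbackD[OF xy]
  have "pullback C (g \<cdot> q) l x (s \<cdot> y)"
    using pullback_swap[OF pullback_paste[OF pullback_swap[OF rs(1)] pullback_swap[OF xy]]] .
  from par_comp_span[OF pq(2) lh(1) this]
  have 1: "par_comp C H (par_comp C G F) = span ((m \<cdot> p) \<cdot> x) (h \<cdot> (s \<cdot> y))"
    using pq mf ng lh by simp
  have "pullback C f (n \<cdot> r) (p \<cdot> x) y"
    using pullback_paste[OF pq(1) xy] .
  from par_comp_span[OF mf(1) rs(2) this]
  have 2: "par_comp C (par_comp C H G) F = span (m \<cdot> (p \<cdot> x)) ((h \<cdot> s) \<cdot> y)"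
    using rs mf ng lh by simp
  show "(H \<cdot>\<^bsub>P\<^esub> G) \<cdot>\<^bsub>P\<^esub> F = H \<cdot>\<^bsub>P\<^esub> (G \<cdot>\<^bsub>P\<^esub> F)"
    using 1 2 dx dp dr d by simp
qed

text \<open>Restriction idempotents are subobjects. \<open>R2\<close> and \<open>R3\<close> hold
  since both sides are given by an intersection \<open>m \<cdot> p = n \<cdot> q\<close>; in
  \<open>R4\<close> both sides restrict \<open>F\<close> to the pullback \<open>p\<close> of the
  domain of \<open>H\<close> along \<open>f\<close>.\<close>

lemma Par_restriction_category: "restriction_category P R"
proof (intro restriction_category.intro restriction_category_axioms.intro Par_category)
  fix F A B assume F: "F \<in> hom P A B"
  obtain m f where mf: "partial_map A B m f" "F = span m f"
    using F by (rule Par_homE)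
  note d = partial_mapD[OF mf(1)]
  show "R F \<in> hom P A A"
    using mf par_restriction_span span_hom[OF partial_map_restriction] by metis
  show "F \<cdot>\<^bsub>P\<^esub> R F = F"
    using span_comp_restriction(1)[OF mf(1) mf(1) pullback_self] mf d
    by (simp add: par_restriction_span[OF mf(1)])
next
  fix F G A B D assume FG: "F \<in> hom P A B" "G \<in> hom P A D"
  obtain m f where mf: "partial_map A B m f" "F = span m f"
    using FG(1) by (rule Par_homE)
  obtain n g where ng: "partial_map A D n g" "G = span n g"
    using FG(2) by (rule Par_homE)
  note d = partial_mapD[OF mf(1)] and e = partial_mapD[OF ng(1)]
  obtain p q where pq: "pullback C m n p q"
    using pullback_obtain[of n m] d e by metis
  note dp = pullbackD[OF pq]
  have 1: "R G \<cdot>\<^bsub>P\<^esub> R F = span (m \<cdot> p) (m \<cdot> p)"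
    using span_comp_restriction(1)[OF mf(1) partial_map_restriction[OF ng(1)] pq] dp mf ng
    by (simp add: par_restriction_span[OF mf(1)] par_restriction_span[OF ng(1)])
  have 2: "R F \<cdot>\<^bsub>P\<^esub> R G = span (m \<cdot> p) (m \<cdot> p)"
    using span_comp_restriction(1)[OF ng(1) partial_map_restriction[OF mf(1)] pullback_swap[OF pq]]
      dp mf ng
    by (simp add: par_restriction_span[OF mf(1)] par_restriction_span[OF ng(1)])
  show "R G \<cdot>\<^bsub>P\<^esub> R F = R F \<cdot>\<^bsub>P\<^esub> R G"
    using 1 2 by simp
  show "R (G \<cdot>\<^bsub>P\<^esub> R F) = R G \<cdot>\<^bsub>P\<^esub> R F"
    using 1 span_comp_restriction[OF mf(1) ng(1) pq] par_restriction_span mf ng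
    by (metis Par_sel(4))
next
  fix F H A B D assume FH: "F \<in> hom P A B" "H \<in> hom P B D"
  obtain m f where mf: "partial_map A B m f" "F = span m f"
    using FH(1) by (rule Par_homE)
  obtain n h where nh: "partial_map B D n h" "H = span n h"
    using FH(2) by (rule Par_homE)
  note d = partial_mapD[OF mf(1)] and e = partial_mapD[OF nh(1)]
  obtain p q where pq: "pullback C f n p q" "partial_map A D (m \<cdot> p) (h \<cdot> q)"
    "par_comp C (span n h) (span m f) = span (m \<cdot> p) (h \<cdot> q)"
    using mf(1) nh(1) by (rule Par_comp_obtain)
  note dp = pullbackD[OF pq(1)]
  have "R H \<cdot>\<^bsub>P\<^esub> F = span (m \<cdot> p) (f \<cdot> p)"
    using par_comp_span[OF mf(1) partial_map_restriction[OF nh(1)] pq(1)] mf nh dp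
    by (simp add: par_restriction_span[OF nh(1)])
  \<comment> \<open>\<open>m \<cdot> p\<close> factors through \<open>m\<close>, so restricting
    \<open>F\<close> to it is precomposition with \<open>p\<close>.\<close>
  moreover have "pullback C (m \<cdot> p) m (Ident C (Dom C p)) p"
    using pullback_along_factor[of m p] M_monic d dp by simp
  then have "F \<cdot>\<^bsub>P\<^esub> R (H \<cdot>\<^bsub>P\<^esub> F) = span (m \<cdot> p) (f \<cdot> p)"
    using span_comp_restriction(1)[OF pq(2) mf(1), of "Ident C (Dom C p)" p] mf nh pq d dp
    by (simp add: par_restriction_span[OF pq(2)])
  ultimately show "R H \<cdot>\<^bsub>P\<^esub> F = F \<cdot>\<^bsub>P\<^esub> R (H \<cdot>\<^bsub>P\<^esub> F)"
    by simp
qed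

section \<open>Order and compatibility of partial maps in terms of representing spans\<close>

lemma restr_le_span:
  assumes "partial_map A B m f" "partial_map A B n g"
  shows "restr_le P R (span m f) (span n g) \<longleftrightarrow>
    (\<exists>u \<in> hom C (Dom C m) (Dom C n). n \<cdot> u = m \<and> g \<cdot> u = f)"
proof -
  note d = partial_mapD[OF assms(1)] and e = partial_mapD[OF assms(2)]
  have le: "restr_le P R (span m f) (span n g) \<longleftrightarrow> span m f = par_comp C (span n g) (span m m)"
    by (simp add: restr_le_def par_restriction_span[OF assms(1)])
  show ?thesis
  proof
    assume "restr_le P R (span m f) (span n g)"
    then have eq: "span m f = par_comp C (span n g) (span m m)" by (simp only: le)
    obtain p q where pq: "pullback C m n p q"
      using pullback_obtain[of n m] d e by metis
    note dp = pullbackD[OF pq] and c = span_comp_restriction[OF assms pq]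
    \<comment> \<open>Equality of the two classes supplies an isomorphism \<open>i\<close> between
      their domains; the required factorisation through \<open>n\<close> is then
      \<open>q \<cdot> i\<close>.\<close>
    obtain i where i: "iso C i" "Cod C i = Dom C (m \<cdot> p)" "m = (m \<cdot> p) \<cdot> i" "f = (g \<cdot> q) \<cdot> i"
      using eq span_eq_iff[OF c(2) assms(1)] unfolding c(1) by blast
    have I: "i \<in> Arr C" using i(1) by (rule iso_Arr)
    have Cod: "Cod C i = Dom C p" using i dp d by simp
    have "n \<cdot> (q \<cdot> i) = m"
      using comp_cong_right[OF dp(9), of i] I Cod i(3) dp d by simp
    moreover have "g \<cdot> (q \<cdot> i) = f"
      using I Cod i(4) dp d e by simp
    moreover have "Dom C i = Dom C m"
      using arg_cong[OF i(3), of "Dom C"] I Cod dp d by simp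
    ultimately show "\<exists>u \<in> hom C (Dom C m) (Dom C n). n \<cdot> u = m \<and> g \<cdot> u = f"
      using I Cod dp by (intro bexI[of _ "q \<cdot> i"]) (auto simp: hom_def)
  next
    assume "\<exists>u \<in> hom C (Dom C m) (Dom C n). n \<cdot> u = m \<and> g \<cdot> u = f"
    then obtain u where u: "u \<in> Arr C" "Dom C u = Dom C m" "Cod C u = Dom C n" "n \<cdot> u = m" "g \<cdot> u = f"
      by (auto simp: hom_def)
    have pq: "pullback C m n (Ident C (Dom C m)) u"
      using pullback_along_factor[of n u] u e M_monic by simp
    show "restr_le P R (span m f) (span n g)"
      unfolding le using span_comp_restriction(1)[OF assms pq] u d by simp
  qed
qed

text \<open>Both composites in the definition of compatibility live on the same subobject
  \<open>m \<cdot> p = n \<cdot> q\<close>, so equality of classes reduces to equality of the second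
  legs.\<close>

lemma compatible_span:
  assumes "partial_map A B m f" "partial_map A B n g" "pullback C m n p q"
  shows "compatible P R (span m f) (span n g) \<longleftrightarrow> f \<cdot> p = g \<cdot> q"
proof -
  note d = partial_mapD[OF assms(1)] and e = partial_mapD[OF assms(2)] and dp = pullbackD[OF assms(3)]
  note c = span_comp_restriction[OF assms]
    and c' = span_comp_restriction[OF assms(2,1) pullback_swap[OF assms(3)]]
  have "compatible P R (span m f) (span n g) \<longleftrightarrow>
      span (n \<cdot> q) (f \<cdot> p) = span (m \<cdot> p) (g \<cdot> q)"
    by (simp add: compatible_def par_restriction_span[OF assms(1)]
      par_restriction_span[OF assms(2)] c c')
  also have "\<dots> \<longleftrightarrow> f \<cdot> p = g \<cdot> q"
  proof
    assume "span (n \<cdot> q) (f \<cdot> p) = span (m \<cdot> p) (g \<cdot> q)"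
    then obtain i where i: "iso C i" "Cod C i = Dom C (m \<cdot> p)" "n \<cdot> q = (m \<cdot> p) \<cdot> i"
      "f \<cdot> p = (g \<cdot> q) \<cdot> i"
      unfolding span_eq_iff[OF c(2) c'(2)] by blast
    have I: "i \<in> Arr C" using i(1) by (rule iso_Arr)
    have Dom: "Dom C i = Dom C p"
      using arg_cong[OF i(4), of "Dom C"] i(2) I dp d e by simp
    have Cod: "Cod C i = Dom C p" using i(2) dp d by simp
    \<comment> \<open>The isomorphism between the two spans fixes the monic
      \<open>m \<cdot> p\<close>, which forces it to be the identity.\<close>
    have "(m \<cdot> p) \<cdot> i = (m \<cdot> p) \<cdot> Ident C (Dom C p)"
      unfolding i(3)[symmetric] dp(9)[symmetric] using dp(1,3,6) by simp
    then have "i = Ident C (Dom C p)"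
      by (rule M_eq[OF _ partial_mapD(1)[OF c(2)]]) (use I Dom Cod dp(1,3,6) in simp_all)
    then show "f \<cdot> p = g \<cdot> q"
      using i(4) dp d e by simp
  qed (use dp in simp)
  finally show ?thesis .
qed

text \<open>The factorisations \<open>u\<close> and \<open>v\<close> through each other are mutually
  inverse because \<open>m\<close> and \<open>n\<close> are monic.\<close>

lemma restr_le_antisym:
  assumes "F \<in> hom P A B" "G \<in> hom P A B" "restr_le P R F G" "restr_le P R G F"
  shows "F = G"
proof -
  obtain m f where mf: "partial_map A B m f" "F = span m f"
    using assms(1) by (rule Par_homE)
  obtain n g where ng: "partial_map A B n g" "G = span n g"
    using assms(2) by (rule Par_homE)
  note d = partial_mapD[OF mf(1)] and e = partial_mapD[OF ng(1)]
  obtain u where u: "u \<in> Arr C" "Dom C u = Dom C m" "Cod C u = Dom C n" "n \<cdot> u = m" "g \<cdot> u = f"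
    using assms(3) restr_le_span[OF mf(1) ng(1)] mf ng by (auto simp: hom_def)
  obtain v where v: "v \<in> Arr C" "Dom C v = Dom C n" "Cod C v = Dom C m" "m \<cdot> v = n" "f \<cdot> v = g"
    using assms(4) restr_le_span[OF ng(1) mf(1)] mf ng by (auto simp: hom_def)
  have "v \<cdot> u = Ident C (Dom C u)"
    by (rule M_eq[of m]) (use u v d e comp_eq_right[OF v(4), of u] in simp_all)
  moreover have "u \<cdot> v = Ident C (Cod C u)"
    by (rule M_eq[of n]) (use u v d e comp_eq_right[OF u(4), of v] in simp_all)
  ultimately have "iso C u" using u v by (intro isoI[of u v]) auto
  then have "span m f = span n g"
    unfolding span_eq_iff[OF ng(1) mf(1)] using u by auto
  then show ?thesis using mf ng by simp
qed

lemma is_join_unique: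
  assumes "is_join P R A B S F" "is_join P R A B S G"
  shows "F = G"
  using assms restr_le_antisym unfolding is_join_def by meson

end

subsection \<open>Colimits of matching diagrams\<close>

text \<open>The cocone condition on the legs at the \<open>Single\<close> vertices. Ranging over all
  pullbacks makes it independent of \<open>chosen_pullback\<close>, so that it also fits pulled back
  diagrams; for monic \<open>m i\<close> the case \<open>i = j\<close> is automatic.\<close>

definition matching :: "('o, 'a) cat \<Rightarrow> 'i set \<Rightarrow> ('i \<Rightarrow> 'a) \<Rightarrow> ('i \<Rightarrow> 'a) \<Rightarrow> bool" where
  "matching C I m d \<longleftrightarrow>
     (\<forall>i\<in>I. \<forall>j\<in>I. \<forall>p q. pullback C (m i) (m j) p q \<longrightarrow> d i \<cdot>\<^bsub>C\<^esub> p = d j \<cdot>\<^bsub>C\<^esub> q)"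

text \<open>The universal property of the colimit, expressed by the legs at the vertices \<open>Single i\<close> only.\<close>

definition gluing :: "('o, 'a) cat \<Rightarrow> 'i set \<Rightarrow> ('i \<Rightarrow> 'a) \<Rightarrow> 'o \<Rightarrow> ('i \<Rightarrow> 'a) \<Rightarrow> bool" where
  "gluing C I m U c \<longleftrightarrow> U \<in> Obj C \<and> (\<forall>i\<in>I. c i \<in> hom C (Dom C (m i)) U) \<and> matching C I m c \<and>
     (\<forall>Y d. Y \<in> Obj C \<longrightarrow> (\<forall>i\<in>I. d i \<in> hom C (Dom C (m i)) Y) \<longrightarrow> matching C I m d \<longrightarrow>
        (\<exists>!u. u \<in> hom C U Y \<and> (\<forall>i\<in>I. u \<cdot>\<^bsub>C\<^esub> c i = d i)))"

text \<open>Pulling back a matching diagram gives pullbacks other than the chosen ones, hence the more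
  general shape.\<close>

definition matching_shape ::
    "('o, 'a) cat \<Rightarrow> 'i set \<Rightarrow> ('i \<Rightarrow> 'a) \<Rightarrow> ('i matching_vertex, 'i matching_edge, 'o, 'a) diagram \<Rightarrow> bool"
  where
  "matching_shape C I m D \<longleftrightarrow>
     Vert D = Vert (matching_diagram C I m) \<and> Edge D = Edge (matching_diagram C I m) \<and>
     Src D = Src (matching_diagram C I m) \<and> Tgt D = Tgt (matching_diagram C I m) \<and>
     (\<forall>i\<in>I. VObj D (Single i) = Dom C (m i)) \<and>
     (\<forall>i\<in>I. \<forall>j\<in>I. i \<noteq> j \<longrightarrow>
        pullback C (m i) (m j) (EArr D (Proj1 i j)) (EArr D (Proj2 i j)) \<and>
        VObj D (Meet i j) = Dom C (EArr D (Proj1 i j)))"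

lemma matching_diagram_sel [simp]:
  "Single i \<in> Vert (matching_diagram C I m) \<longleftrightarrow> i \<in> I"
  "Meet i j \<in> Vert (matching_diagram C I m) \<longleftrightarrow> i \<in> I \<and> j \<in> I \<and> i \<noteq> j"
  "Proj1 i j \<in> Edge (matching_diagram C I m) \<longleftrightarrow> i \<in> I \<and> j \<in> I \<and> i \<noteq> j"
  "Proj2 i j \<in> Edge (matching_diagram C I m) \<longleftrightarrow> i \<in> I \<and> j \<in> I \<and> i \<noteq> j"
  "Src (matching_diagram C I m) (Proj1 i j) = Meet i j"
  "Src (matching_diagram C I m) (Proj2 i j) = Meet i j"
  "Tgt (matching_diagram C I m) (Proj1 i j) = Single i"
  "Tgt (matching_diagram C I m) (Proj2 i j) = Single j"
  by (auto simp: matching_diagram_def)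

lemma ball_matching_vertex:
  "(\<forall>v \<in> Vert (matching_diagram C I m). Q v) \<longleftrightarrow>
    (\<forall>i\<in>I. Q (Single i)) \<and> (\<forall>i\<in>I. \<forall>j\<in>I. i \<noteq> j \<longrightarrow> Q (Meet i j))"
  by (auto simp: matching_diagram_def)

lemma ball_matching_edge:
  "(\<forall>e \<in> Edge (matching_diagram C I m). Q e) \<longleftrightarrow>
    (\<forall>i\<in>I. \<forall>j\<in>I. i \<noteq> j \<longrightarrow> Q (Proj1 i j) \<and> Q (Proj2 i j))"
  by (auto simp: matching_diagram_def)

context M_category
begin

lemma subobject_familyD:
  assumes "subobject_family C M A I m" "i \<in> I"
  shows "m i \<in> M" "m i \<in> Arr C" "Cod C (m i) = A" "Dom C (m i) \<in> Obj C"
  using assms by (auto simp: subobject_family_def)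

lemma matching_at_pullback:
  assumes "pullback C m n p q" "pullback C m n p' q'" "d \<cdot> p = e \<cdot> q"
    "d \<in> hom C (Dom C m) Y" "e \<in> hom C (Dom C n) Y"
  shows "d \<cdot> p' = e \<cdot> q'"
proof -
  note h = pullbackD[OF assms(1)]
  obtain i where i: "iso C i" "Dom C i = Dom C p'" "Cod C i = Dom C p" "p' = p \<cdot> i" "q' = q \<cdot> i"
    using assms(1,2) by (rule pullback_unique_iso)
  have "d \<cdot> (p \<cdot> i) = e \<cdot> (q \<cdot> i)"
    by (rule comp_cong_right[OF assms(3)])
      (use assms(4,5) h i iso_Arr[OF i(1)] in \<open>simp_all add: hom_def\<close>)
  then show ?thesis using i by simp
qed

text \<open>One pullback per pair suffices, as any other differs by an isomorphism; for
  \<open>i = j\<close> the two projections coincide because \<open>m i\<close> is monic.\<close>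

lemma matchingI:
  assumes "subobject_family C M A I m" "\<And>i. i \<in> I \<Longrightarrow> d i \<in> hom C (Dom C (m i)) Y"
    and ex: "\<And>i j. \<lbrakk>i \<in> I; j \<in> I; i \<noteq> j\<rbrakk> \<Longrightarrow> \<exists>p q. pullback C (m i) (m j) p q \<and> d i \<cdot> p = d j \<cdot> q"
  shows "matching C I m d"
  unfolding matching_def
proof (intro ballI allI impI)
  fix i j p q assume ij: "i \<in> I" "j \<in> I" and pq: "pullback C (m i) (m j) p q"
  show "d i \<cdot> p = d j \<cdot> q"
  proof (cases "i = j")
    case True
    note h = pullbackD[OF pq]
    have "p = q"
      by (rule M_eq[of "m i"]) (use h True subobject_familyD[OF assms(1)] ij in simp_all)
    then show ?thesis using True by simp
  next
    case False
    then obtain p' q' where "pullback C (m i) (m j) p' q'" "d i \<cdot> p' = d j \<cdot> q'"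
      using ex ij by blast
    then show ?thesis using matching_at_pullback pq assms(2) ij by blast
  qed
qed

lemma matchingD:
  "\<lbrakk>matching C I m d; i \<in> I; j \<in> I; pullback C (m i) (m j) p q\<rbrakk> \<Longrightarrow> d i \<cdot> p = d j \<cdot> q"
  by (auto simp: matching_def)

lemma matching_self: "matching C I m m"
  by (auto simp: matching_def dest: pullbackD)

lemma matching_comp:
  assumes "matching C I m c" "\<And>i. i \<in> I \<Longrightarrow> c i \<in> hom C (Dom C (m i)) U" "f \<in> hom C U Y"
  shows "matching C I m (\<lambda>i. f \<cdot> c i)"
  unfolding matching_def
proof (intro ballI allI impI)
  fix i j p q assume ij: "i \<in> I" "j \<in> I" and pq: "pullback C (m i) (m j) p q"
  show "(f \<cdot> c i) \<cdot> p = (f \<cdot> c j) \<cdot> q"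
    using matchingD[OF assms(1) ij pq] assms(2)[OF ij(1)] assms(2)[OF ij(2)] assms(3) pullbackD[OF pq]
    by (simp add: hom_def)
qed

text \<open>\<open>m\<close> matches with itself, and the monic \<open>n\<close> cancels from the
  resulting equations. Thus an upper bound of a family of partial maps yields a cocone.\<close>

lemma matching_factor:
  assumes "n \<in> M" "\<And>i. i \<in> I \<Longrightarrow> u i \<in> hom C (Dom C (m i)) (Dom C n)"
    "\<And>i. i \<in> I \<Longrightarrow> n \<cdot> u i = m i"
  shows "matching C I m u"
  unfolding matching_def
proof (intro ballI allI impI)
  fix i j p q assume ij: "i \<in> I" "j \<in> I" and pq: "pullback C (m i) (m j) p q"
  note h = pullbackD[OF pq]
  note u = homD[OF assms(2)[OF ij(1)]] homD[OF assms(2)[OF ij(2)]]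
  have "n \<cdot> (u i \<cdot> p) = m i \<cdot> p" "n \<cdot> (u j \<cdot> q) = m j \<cdot> q"
    using comp_eq_right[OF assms(3)[OF ij(1)], of p] comp_eq_right[OF assms(3)[OF ij(2)], of q]
      h(3,4,6,7) u assms(1) by simp_all
  then have "n \<cdot> (u i \<cdot> p) = n \<cdot> (u j \<cdot> q)" using h(9) by simp
  then show "u i \<cdot> p = u j \<cdot> q"
    by (rule M_eq[OF _ assms(1)]) (use h u in simp_all)
qed

lemma gluingD:
  assumes "gluing C I m U c"
  shows "U \<in> Obj C" "i \<in> I \<Longrightarrow> c i \<in> hom C (Dom C (m i)) U" "matching C I m c"
  using assms by (auto simp: gluing_def)

lemma gluing_ex1:
  assumes "gluing C I m U c" "Y \<in> Obj C" "\<And>i. i \<in> I \<Longrightarrow> d i \<in> hom C (Dom C (m i)) Y"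
    "matching C I m d"
  shows "\<exists>!u. u \<in> hom C U Y \<and> (\<forall>i\<in>I. u \<cdot> c i = d i)"
  using assms(1)[unfolded gluing_def, THEN conjunct2, THEN conjunct2, THEN conjunct2,
      rule_format, of Y d] assms(2-) by simp

lemma gluing_ex:
  assumes "gluing C I m U c" "Y \<in> Obj C" "\<And>i. i \<in> I \<Longrightarrow> d i \<in> hom C (Dom C (m i)) Y"
    "matching C I m d"
  obtains u where "u \<in> hom C U Y" "\<And>i. i \<in> I \<Longrightarrow> u \<cdot> c i = d i"
  using ex1_implies_ex[OF gluing_ex1[OF assms(1-4)]] that by blast

text \<open>The legs are jointly epic: \<open>u\<close> and \<open>v\<close> both mediate to the
  matching family of the composites \<open>u \<cdot> c i\<close>.\<close>

lemma gluing_unique: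
  assumes "gluing C I m U c" "u \<in> hom C U Y" "v \<in> hom C U Y" "\<And>i. i \<in> I \<Longrightarrow> u \<cdot> c i = v \<cdot> c i"
  shows "u = v"
proof -
  note c = gluingD[OF assms(1)]
  have "matching C I m (\<lambda>i. u \<cdot> c i)"
    using matching_comp[OF c(3,2) assms(2)] by blast
  moreover have "u \<cdot> c i \<in> hom C (Dom C (m i)) Y" if "i \<in> I" for i
    using c(2)[OF that] assms(2) by (simp add: hom_def)
  moreover have "Y \<in> Obj C" using assms(2) Cod_Obj by (auto simp: hom_def)
  ultimately have "\<exists>!w. w \<in> hom C U Y \<and> (\<forall>i\<in>I. w \<cdot> c i = u \<cdot> c i)"
    using gluing_ex1[OF assms(1), of Y "\<lambda>i. u \<cdot> c i"] by blast
  then show ?thesis using assms by metis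
qed

lemma gluing_iso:
  assumes "gluing C I m U c" "gluing C I m V d"
  obtains w where "iso C w" "w \<in> hom C U V" "\<And>i. i \<in> I \<Longrightarrow> w \<cdot> c i = d i"
proof -
  note c = gluingD[OF assms(1)] and d = gluingD[OF assms(2)]
  obtain w where w: "w \<in> hom C U V" "\<And>i. i \<in> I \<Longrightarrow> w \<cdot> c i = d i"
    using gluing_ex[OF assms(1) d(1,2,3)] by metis
  obtain x where x: "x \<in> hom C V U" "\<And>i. i \<in> I \<Longrightarrow> x \<cdot> d i = c i"
    using gluing_ex[OF assms(2) c(1,2,3)] by metis
  note w' = homD[OF w(1)] and x' = homD[OF x(1)]
  have "x \<cdot> w = Ident C U"
  proof (rule gluing_unique[OF assms(1)])
    fix i assume i: "i \<in> I"
    show "(x \<cdot> w) \<cdot> c i = Ident C U \<cdot> c i"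
      using w(2)[OF i] x(2)[OF i] w' x' homD[OF c(2)[OF i]] c(1) by simp
  qed (use w' x' c(1) in \<open>auto simp: hom_def\<close>)
  moreover have "w \<cdot> x = Ident C V"
  proof (rule gluing_unique[OF assms(2)])
    fix i assume i: "i \<in> I"
    show "(w \<cdot> x) \<cdot> d i = Ident C V \<cdot> d i"
      using w(2)[OF i] x(2)[OF i] w' x' homD[OF d(2)[OF i]] d(1) by simp
  qed (use w' x' d(1) in \<open>auto simp: hom_def\<close>)
  ultimately have "iso C w" using w' x' by (intro isoI[of w x]) auto
  with w that show ?thesis by blast
qed

section \<open>Colimits of matching diagrams expressed as gluings\<close>

lemma matching_shape_diagram:
  assumes "subobject_family C M A I m"
  shows "matching_shape C I m (matching_diagram C I m)"
  unfolding matching_shape_def using subobject_familyD[OF assms]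
  by (auto simp: matching_diagram_def intro!: chosen_pullback)

text \<open>The edge \<open>Proj1 i j\<close> determines the leg at \<open>Meet i j\<close>, and the
  edge \<open>Proj2 i j\<close> then imposes exactly the matching condition.\<close>

lemma cocone_iff:
  assumes "subobject_family C M A I m" "matching_shape C I m D"
  shows "cocone C D X c \<longleftrightarrow> X \<in> Obj C \<and> (\<forall>i\<in>I. c (Single i) \<in> hom C (Dom C (m i)) X) \<and>
    matching C I m (\<lambda>i. c (Single i)) \<and>
    (\<forall>i\<in>I. \<forall>j\<in>I. i \<noteq> j \<longrightarrow> c (Meet i j) = c (Single i) \<cdot> EArr D (Proj1 i j))"
    (is "_ \<longleftrightarrow> ?X \<and> ?h \<and> ?m \<and> ?M")
proof -
  have D: "Vert D = Vert (matching_diagram C I m)" "Edge D = Edge (matching_diagram C I m)"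
     "Src D = Src (matching_diagram C I m)" "Tgt D = Tgt (matching_diagram C I m)"
     "\<And>i. i \<in> I \<Longrightarrow> VObj D (Single i) = Dom C (m i)"
     "\<And>i j. \<lbrakk>i \<in> I; j \<in> I; i \<noteq> j\<rbrakk> \<Longrightarrow> pullback C (m i) (m j) (EArr D (Proj1 i j)) (EArr D (Proj2 i j))"
     "\<And>i j. \<lbrakk>i \<in> I; j \<in> I; i \<noteq> j\<rbrakk> \<Longrightarrow> VObj D (Meet i j) = Dom C (EArr D (Proj1 i j))"
    using assms(2) unfolding matching_shape_def by blast+
  show ?thesis
  proof
    assume "cocone C D X c"
    then have c: "X \<in> Obj C" "\<And>i. i \<in> I \<Longrightarrow> c (Single i) \<in> hom C (Dom C (m i)) X"
      "\<And>i j. \<lbrakk>i \<in> I; j \<in> I; i \<noteq> j\<rbrakk> \<Longrightarrow> c (Single i) \<cdot> EArr D (Proj1 i j) = c (Meet i j)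
         \<and> c (Single j) \<cdot> EArr D (Proj2 i j) = c (Meet i j)"
      unfolding cocone_def D(1-4) ball_matching_vertex ball_matching_edge by (auto simp: D(5))
    have "matching C I m (\<lambda>i. c (Single i))"
      using matchingI[OF assms(1), of "\<lambda>i. c (Single i)" X] c D(6) by metis
    with c show "?X \<and> ?h \<and> ?m \<and> ?M" by auto
  next
    assume c: "?X \<and> ?h \<and> ?m \<and> ?M"
    have "c (Meet i j) \<in> hom C (VObj D (Meet i j)) X"
      "c (Single j) \<cdot> EArr D (Proj2 i j) = c (Meet i j)" if ij: "i \<in> I" "j \<in> I" "i \<noteq> j" for i j
    proof -
      have ci: "c (Single i) \<in> hom C (Dom C (m i)) X" using c ij by blast
      show "c (Meet i j) \<in> hom C (VObj D (Meet i j)) X"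
        using c ij homD[OF ci] pullbackD[OF D(6)[OF ij]] D(7)[OF ij] by (auto simp: hom_def)
      show "c (Single j) \<cdot> EArr D (Proj2 i j) = c (Meet i j)"
        using c ij matchingD[of I m "\<lambda>i. c (Single i)", OF _ ij(1,2) D(6)[OF ij]] by simp
    qed
    then show "cocone C D X c"
      unfolding cocone_def D(1-4) ball_matching_vertex ball_matching_edge using c by (simp add: D(5))
  qed
qed

lemma mediates_iff:
  assumes "subobject_family C M A I m" "matching_shape C I m D" "cocone C D X c" "cocone C D Y d"
  shows "mediates C D X c Y d u \<longleftrightarrow> u \<in> hom C X Y \<and> (\<forall>i\<in>I. u \<cdot> c (Single i) = d (Single i))"
proof -
  note c = assms(3)[unfolded cocone_iff[OF assms(1,2)]]
    and d = assms(4)[unfolded cocone_iff[OF assms(1,2)]]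
  have V: "Vert D = Vert (matching_diagram C I m)"
    "\<And>i j. \<lbrakk>i \<in> I; j \<in> I; i \<noteq> j\<rbrakk> \<Longrightarrow> pullback C (m i) (m j) (EArr D (Proj1 i j)) (EArr D (Proj2 i j))"
    using assms(2) by (auto simp: matching_shape_def)
  have "u \<cdot> c (Meet i j) = d (Meet i j)"
    if u: "u \<in> hom C X Y" "\<forall>i\<in>I. u \<cdot> c (Single i) = d (Single i)" and ij: "i \<in> I" "j \<in> I" "i \<noteq> j" for i j
  proof -
    have ci: "c (Single i) \<in> hom C (Dom C (m i)) X" using c ij by blast
    have "u \<cdot> (c (Single i) \<cdot> EArr D (Proj1 i j)) = d (Single i) \<cdot> EArr D (Proj1 i j)"
      by (rule comp_eq_right)
        (use u ij homD[OF ci] homD[OF u(1)] pullbackD[OF V(2)[OF ij]] in simp_all)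
    then show ?thesis using c d ij by simp
  qed
  then show ?thesis
    unfolding mediates_def V(1) ball_matching_vertex by blast
qed

lemma colimit_iff:
  assumes "subobject_family C M A I m" "matching_shape C I m D"
  shows "colimit C D U c \<longleftrightarrow> gluing C I m U (\<lambda>i. c (Single i)) \<and>
    (\<forall>i\<in>I. \<forall>j\<in>I. i \<noteq> j \<longrightarrow> c (Meet i j) = c (Single i) \<cdot> EArr D (Proj1 i j))"
proof
  assume col: "colimit C D U c"
  then have coc: "cocone C D U c" by (simp add: colimit_def)
  note c = coc[unfolded cocone_iff[OF assms]]
  have "\<exists>!u. u \<in> hom C U Y \<and> (\<forall>i\<in>I. u \<cdot> c (Single i) = d i)"
    if Y: "Y \<in> Obj C" "\<forall>i\<in>I. d i \<in> hom C (Dom C (m i)) Y" "matching C I m d" for Y d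
  proof -
    \<comment> \<open>A matching family is completed to a cocone by the only possible legs at the
      \<open>Meet\<close> vertices.\<close>
    define d' where "d' v = (case v of Single i \<Rightarrow> d i | Meet i j \<Rightarrow> d i \<cdot> EArr D (Proj1 i j))" for v
    have d': "cocone C D Y d'"
      unfolding cocone_iff[OF assms] d'_def using Y by simp
    then have "\<exists>!u. mediates C D U c Y d' u"
      using col unfolding colimit_def by blast
    then show ?thesis
      unfolding mediates_iff[OF assms coc d'] by (simp add: d'_def)
  qed
  then show "gluing C I m U (\<lambda>i. c (Single i)) \<and>
    (\<forall>i\<in>I. \<forall>j\<in>I. i \<noteq> j \<longrightarrow> c (Meet i j) = c (Single i) \<cdot> EArr D (Proj1 i j))"
    unfolding gluing_def using c by blast
next
  assume g: "gluing C I m U (\<lambda>i. c (Single i)) \<and>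
    (\<forall>i\<in>I. \<forall>j\<in>I. i \<noteq> j \<longrightarrow> c (Meet i j) = c (Single i) \<cdot> EArr D (Proj1 i j))"
  then have coc: "cocone C D U c"
    unfolding cocone_iff[OF assms] gluing_def by blast
  have "\<exists>!u. mediates C D U c Y d u" if d: "cocone C D Y d" for Y d
    unfolding mediates_iff[OF assms coc d]
    by (rule gluing_ex1) (use g d[unfolded cocone_iff[OF assms]] in auto)
  with coc show "colimit C D U c" by (simp add: colimit_def)
qed

text \<open>The family \<open>m\<close> matches with itself, so \<open>matching_cocone\<close> is a
  cocone with vertex \<open>A\<close>; the colimit property justifies the \<open>THE\<close> in
  \<open>induced_map\<close>.\<close>

lemma join_map_hom:
  assumes "subobject_family C M A I m" "colimit C (matching_diagram C I m) U c"
  shows "join_map C A I m U c \<in> hom C U A"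
    "i \<in> I \<Longrightarrow> join_map C A I m U c \<cdot> c (Single i) = m i"
proof -
  note sh = matching_shape_diagram[OF assms(1)]
  have coc: "cocone C (matching_diagram C I m) A (matching_cocone C m)"
    unfolding cocone_iff[OF assms(1) sh] using matching_self assms(1) subobject_familyD[OF assms(1)]
    by (auto simp: matching_cocone_def matching_diagram_def hom_def subobject_family_def)
  then have "\<exists>!u. mediates C (matching_diagram C I m) U c A (matching_cocone C m) u"
    using assms(2) by (simp add: colimit_def)
  then have "mediates C (matching_diagram C I m) U c A (matching_cocone C m) (join_map C A I m U c)"
    unfolding join_map_def induced_map_def by (rule theI')
  then show "join_map C A I m U c \<in> hom C U A"
    "i \<in> I \<Longrightarrow> join_map C A I m U c \<cdot> c (Single i) = m i"
    by (auto simp: mediates_def matching_cocone_def)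
qed

section \<open>Pulling back matching diagrams along maps into the colimit\<close>

lemma leg_in_M:
  assumes fam: "subobject_family C M A I m" and sh: "matching_shape C I m D"
    and col: "colimit C D U c" and k: "k \<in> M" "k \<in> hom C U A"
    and kc: "\<And>i. i \<in> I \<Longrightarrow> k \<cdot> c (Single i) = m i"
    and v: "v \<in> Vert D"
  shows "c v \<in> M" "Cod C (c v) = U"
proof -
  note c = col[unfolded colimit_iff[OF fam sh] gluing_def]
  have S: "c (Single i) \<in> M" "Cod C (c (Single i)) = U" if "i \<in> I" for i
  proof -
    have ci: "c (Single i) \<in> hom C (Dom C (m i)) U" using c that by blast
    then show "Cod C (c (Single i)) = U" by (simp add: hom_def)
    \<comment> \<open>Both \<open>k\<close> and \<open>k \<cdot> c (Single i) = m i\<close> lie in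
      \<open>M\<close>, so cancellation applies.\<close>
    show "c (Single i) \<in> M"
      by (rule M_cancel[of k])
        (use homD[OF ci] homD[OF k(2)] k(1) kc[OF that] subobject_familyD[OF fam that] in auto)
  qed
  have "c (Meet i j) \<in> M \<and> Cod C (c (Meet i j)) = U" if ij: "i \<in> I" "j \<in> I" "i \<noteq> j" for i j
  proof -
    have pb: "pullback C (m i) (m j) (EArr D (Proj1 i j)) (EArr D (Proj2 i j))"
      using sh ij by (auto simp: matching_shape_def)
    have "EArr D (Proj1 i j) \<in> M"
      using M_pullback_closed[OF _ pb] subobject_familyD[OF fam] ij by blast
    moreover have "c (Single i) \<in> hom C (Dom C (m i)) U" using c ij by blast
    ultimately show ?thesis
      using c ij M_Comp[OF S(1)[OF ij(1)]] pullbackD[OF pb] by (auto simp: hom_def)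
  qed
  moreover have "v \<in> Vert (matching_diagram C I m)" using v sh by (simp add: matching_shape_def)
  ultimately show "c v \<in> M" "Cod C (c v) = U"
    using S by (cases v; simp)+
qed

text \<open>Pulling back subobjects preserves their intersections, so the pulled back diagram is
  again of matching shape, now for the family of the \<open>p (Single i)\<close>. This makes
  \<open>colimit_iff\<close> applicable to it.\<close>

lemma pullback_of_matching_shape:
  assumes fam: "subobject_family C M A I m" and sh: "matching_shape C I m D"
    and col: "colimit C D U c" and k: "k \<in> M" "k \<in> hom C U A"
    and kc: "\<And>i. i \<in> I \<Longrightarrow> k \<cdot> c (Single i) = m i"
    and f: "f \<in> Arr C" "Cod C f = U"
    and pq: "\<And>v. v \<in> Vert D \<Longrightarrow> pullback C f (c v) (p v) (q v)"
    and t: "\<And>e. e \<in> Edge D \<Longrightarrow> t e \<in> hom C (Dom C (p (Src D e))) (Dom C (p (Tgt D e)))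
       \<and> p (Tgt D e) \<cdot> t e = p (Src D e) \<and> q (Tgt D e) \<cdot> t e = EArr D e \<cdot> q (Src D e)"
  shows "subobject_family C M (Dom C f) I (\<lambda>i. p (Single i))"
    "matching_shape C I (\<lambda>i. p (Single i)) (D\<lparr>VObj := \<lambda>v. Dom C (p v), EArr := t\<rparr>)"
proof -
  note c = col[unfolded colimit_iff[OF fam sh] gluing_def]
  have D: "Vert D = Vert (matching_diagram C I m)" "Edge D = Edge (matching_diagram C I m)"
     "Src D = Src (matching_diagram C I m)" "Tgt D = Tgt (matching_diagram C I m)"
     "\<And>i j. \<lbrakk>i \<in> I; j \<in> I; i \<noteq> j\<rbrakk> \<Longrightarrow> pullback C (m i) (m j) (EArr D (Proj1 i j)) (EArr D (Proj2 i j))"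
    using sh unfolding matching_shape_def by blast+
  note leg = leg_in_M[OF fam sh col k kc]
  have pM: "p v \<in> M" "Cod C (p v) = Dom C f" if "v \<in> Vert D" for v
    using M_pullback_closed[OF leg(1)[OF _ that] pq[OF that]] pullbackD[OF pq[OF that]] by auto
  then show "subobject_family C M (Dom C f) I (\<lambda>i. p (Single i))"
    using f D by (auto simp: subobject_family_def)
  have "pullback C (p (Single i)) (p (Single j)) (t (Proj1 i j)) (t (Proj2 i j)) \<and>
      Dom C (t (Proj1 i j)) = Dom C (p (Meet i j))"
    if ij: "i \<in> I" "j \<in> I" "i \<noteq> j" for i j
  proof -
    let ?E1 = "EArr D (Proj1 i j)" and ?E2 = "EArr D (Proj2 i j)"
    note pb = D(5)[OF ij] and h = pullbackD[OF D(5)[OF ij]]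
    have t1: "t (Proj1 i j) \<in> hom C (Dom C (p (Meet i j))) (Dom C (p (Single i)))"
      "p (Single i) \<cdot> t (Proj1 i j) = p (Meet i j)"
      "q (Single i) \<cdot> t (Proj1 i j) = ?E1 \<cdot> q (Meet i j)"
      and t2: "t (Proj2 i j) \<in> hom C (Dom C (p (Meet i j))) (Dom C (p (Single j)))"
      "p (Single j) \<cdot> t (Proj2 i j) = p (Meet i j)"
      "q (Single j) \<cdot> t (Proj2 i j) = ?E2 \<cdot> q (Meet i j)"
      using t[of "Proj1 i j"] t[of "Proj2 i j"] ij by (auto simp: D)
    note T1 = homD[OF t1(1)] and T2 = homD[OF t2(1)]
    have v: "Single i \<in> Vert D" "Single j \<in> Vert D" "Meet i j \<in> Vert D"
      using ij by (auto simp: D)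
    note pi = pM[OF v(1)] and pj = pM[OF v(2)] and pm = pM[OF v(3)]
    note hi = pullbackD[OF pq[OF v(1)]] and hj = pullbackD[OF pq[OF v(2)]]
      and hm = pullbackD[OF pq[OF v(3)]]
    have ci: "c (Single i) \<in> hom C (Dom C (m i)) U" and cj: "c (Single j) \<in> hom C (Dom C (m j)) U"
      and cm: "c (Meet i j) = c (Single i) \<cdot> ?E1"
      using c ij by auto
    note Ci = homD[OF ci] and Cj = homD[OF cj] and K = homD[OF k(2)]
    have "pullback C (p (Single i)) (p (Single j)) (t (Proj1 i j)) (t (Proj2 i j))"
    proof (rule pullbackI, goal_cases)
      case (10 r s)
      note rs = 10
      have ri: "f \<cdot> (p (Single i) \<cdot> r) = c (Single i) \<cdot> (q (Single i) \<cdot> r)"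
        by (rule comp_cong_right[OF hi(9)]) (use rs hi in simp_all)
      have sj: "f \<cdot> (p (Single j) \<cdot> s) = c (Single j) \<cdot> (q (Single j) \<cdot> s)"
        by (rule comp_cong_right[OF hj(9)]) (use rs hj in simp_all)
      have "c (Single i) \<cdot> (q (Single i) \<cdot> r) = c (Single j) \<cdot> (q (Single j) \<cdot> s)"
        using ri sj rs(6) by simp
      \<comment> \<open>Composing with \<open>k\<close> moves the equation from \<open>U\<close> to
        \<open>A\<close>, where the meet is a pullback of \<open>m i\<close> and \<open>m j\<close>.
        This gives \<open>w\<close> into the meet, and then \<open>u\<close> into its pullback along
        \<open>f\<close>.\<close>
      then have "k \<cdot> (c (Single i) \<cdot> (q (Single i) \<cdot> r)) = k \<cdot> (c (Single j) \<cdot> (q (Single j) \<cdot> s))"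
        by simp
      moreover have "k \<cdot> (c (Single i) \<cdot> (q (Single i) \<cdot> r)) = m i \<cdot> (q (Single i) \<cdot> r)"
        by (rule comp_eq_right[OF kc[OF ij(1)]]) (use K Ci hi(1-8) rs(1-5) in simp_all)
      moreover have "k \<cdot> (c (Single j) \<cdot> (q (Single j) \<cdot> s)) = m j \<cdot> (q (Single j) \<cdot> s)"
        by (rule comp_eq_right[OF kc[OF ij(2)]]) (use K Cj hj(1-8) rs(1-5) in simp_all)
      ultimately have eq: "m i \<cdot> (q (Single i) \<cdot> r) = m j \<cdot> (q (Single j) \<cdot> s)" by simp
      obtain w where w: "w \<in> Arr C" "Dom C w = Dom C (q (Single j) \<cdot> s)" "Cod C w = Dom C ?E1"
        "?E1 \<cdot> w = q (Single i) \<cdot> r" "?E2 \<cdot> w = q (Single j) \<cdot> s"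
        by (rule pullback_ex[OF pb _ _ _ _ _ eq])
          (use h(1-8) Ci Cj hi(1-8) hj(1-8) rs(1-5) in simp_all)
      have "f \<cdot> (p (Single i) \<cdot> r) = c (Meet i j) \<cdot> w"
        unfolding ri cm using w h Ci by simp
      then obtain u where u: "u \<in> Arr C" "Dom C u = Dom C w" "Cod C u = Dom C (p (Meet i j))"
        "p (Meet i j) \<cdot> u = p (Single i) \<cdot> r" "q (Meet i j) \<cdot> u = w"
        using pullback_ex[OF pq[OF v(3)], of "p (Single i) \<cdot> r" w] w(1-3) rs(1-5) hi(1-8) hj(1-8) hm(1-8) cm h Ci
        by (metis comp_Arr)
      have "t (Proj1 i j) \<cdot> u = r"
        by (rule M_eq[OF _ pi(1)])
          (use comp_eq_right[OF t1(2), of u] T1 u w(1-3) rs(1-5) hi(1-8) hj(1-8) in simp_all)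
      moreover have "t (Proj2 i j) \<cdot> u = s"
        by (rule M_eq[OF _ pj(1)])
          (use comp_eq_right[OF t2(2), of u] T2 u w(1-3) rs hi(1-8) hj(1-8) in simp_all)
      ultimately show ?case
        using u w(1-3) rs(1-5) hj(1-8) T2 by (intro exI[of _ u]) simp
    next
      case (11 u v)
      have "p (Single i) \<cdot> (t (Proj1 i j) \<cdot> u) = p (Single i) \<cdot> (t (Proj1 i j) \<cdot> v)"
        using 11 by simp
      \<comment> \<open>\<open>p (Meet i j)\<close> equals
        \<open>p (Single i) \<cdot> t (Proj1 i j)\<close> and is monic, which gives
        uniqueness.\<close>
      then have "p (Meet i j) \<cdot> u = p (Meet i j) \<cdot> v"
        using comp_eq_right[OF t1(2), of u] comp_eq_right[OF t1(2), of v] 11(1-5) T1 T2 hi(1-8) by simp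
      then show ?case
        by (rule M_eq[OF _ pm(1)]) (use 11(1-5) T2 hm(1-8) in simp_all)
    qed (use T1 T2 t1 t2 pi pj in simp_all)
    then show ?thesis using T1 by simp
  qed
  then show "matching_shape C I (\<lambda>i. p (Single i)) (D\<lparr>VObj := \<lambda>v. Dom C (p v), EArr := t\<rparr>)"
    unfolding matching_shape_def using D(1-4) by (simp add: matching_diagram_def)
qed

text \<open>As the pulled back diagram has matching shape, only the gluing property of its legs at
  the \<open>Single\<close> vertices remains to be checked.\<close>

lemma stable_under_pullbackI:
  assumes fam: "subobject_family C M A I m" and sh: "matching_shape C I m D"
    and col: "colimit C D U c" and k: "k \<in> M" "k \<in> hom C U A"
    and kc: "\<And>i. i \<in> I \<Longrightarrow> k \<cdot> c (Single i) = m i"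
    and gl: "\<And>f p q. \<lbrakk>f \<in> Arr C; Cod C f = U; \<And>i. i \<in> I \<Longrightarrow> pullback C f (c (Single i)) (p i) (q i)\<rbrakk>
      \<Longrightarrow> gluing C I p (Dom C f) p"
  shows "stable_under_pullback C D U c"
  unfolding stable_under_pullback_def
proof (intro ballI impI conjI allI; (elim conjE)?)
  fix f v assume "f \<in> Arr C" "Cod C f = U" "v \<in> Vert D"
  then show "\<exists>p q. pullback C f (c v) p q"
    using leg_in_M[OF fam sh col k kc] pullback_obtain by metis
next
  fix f p q t
  assume f: "f \<in> Arr C" "Cod C f = U" and pq: "\<forall>v\<in>Vert D. pullback C f (c v) (p v) (q v)"
    and t: "\<forall>e\<in>Edge D. t e \<in> hom C (Dom C (p (Src D e))) (Dom C (p (Tgt D e)))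
       \<and> p (Tgt D e) \<cdot> t e = p (Src D e) \<and> q (Tgt D e) \<cdot> t e = EArr D e \<cdot> q (Src D e)"
  note pulled = pullback_of_matching_shape[OF fam sh col k kc f, of p q t,
      OF _ bspec[OF pq] bspec[OF t]]
  have D: "Vert D = Vert (matching_diagram C I m)" "Edge D = Edge (matching_diagram C I m)"
     "Src D = Src (matching_diagram C I m)" "Tgt D = Tgt (matching_diagram C I m)"
    using sh unfolding matching_shape_def by blast+
  have "gluing C I (\<lambda>i. p (Single i)) (Dom C f) (\<lambda>i. p (Single i))"
    by (rule gl[OF f, of _ "\<lambda>i. q (Single i)"]) (use pq D in auto)
  moreover have "p (Meet i j) = p (Single i) \<cdot> t (Proj1 i j)" if "i \<in> I" "j \<in> I" "i \<noteq> j" for i j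
    using bspec[OF t, of "Proj1 i j"] that by (simp add: D)
  ultimately show "colimit C (D\<lparr>VObj := \<lambda>v. Dom C (p v), EArr := t\<rparr>) (Dom C f) p"
    using colimit_iff[OF pulled] by simp
qed

text \<open>Stability speaks of pullbacks at all vertices and of connecting maps at all edges.
  Pullbacks given at the \<open>Single\<close> vertices alone are first extended to such
  data.\<close>

lemma stable_under_pullbackD:
  assumes fam: "subobject_family C M A I m" and sh: "matching_shape C I m D"
    and col: "colimit C D U c" and k: "k \<in> M" "k \<in> hom C U A"
    and kc: "\<And>i. i \<in> I \<Longrightarrow> k \<cdot> c (Single i) = m i"
    and stable: "stable_under_pullback C D U c"
    and f: "f \<in> Arr C" "Cod C f = U"
    and pq: "\<And>i. i \<in> I \<Longrightarrow> pullback C f (c (Single i)) (p i) (q i)"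
  shows "gluing C I p (Dom C f) p"
proof -
  have coc: "\<forall>e\<in>Edge D. c (Tgt D e) \<cdot> EArr D e = c (Src D e)"
    and col_hom: "\<And>v. v \<in> Vert D \<Longrightarrow> c v \<in> hom C (VObj D v) U"
    using col by (auto simp: colimit_def cocone_def)
  have D: "Vert D = Vert (matching_diagram C I m)" "Edge D = Edge (matching_diagram C I m)"
     "Src D = Src (matching_diagram C I m)" "Tgt D = Tgt (matching_diagram C I m)"
     "\<And>i. i \<in> I \<Longrightarrow> VObj D (Single i) = Dom C (m i)"
     "\<And>i j. \<lbrakk>i \<in> I; j \<in> I; i \<noteq> j\<rbrakk> \<Longrightarrow> pullback C (m i) (m j) (EArr D (Proj1 i j)) (EArr D (Proj2 i j))"
     "\<And>i j. \<lbrakk>i \<in> I; j \<in> I; i \<noteq> j\<rbrakk> \<Longrightarrow> VObj D (Meet i j) = Dom C (EArr D (Proj1 i j))"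
    using sh unfolding matching_shape_def by blast+
  have E: "EArr D e \<in> hom C (VObj D (Src D e)) (VObj D (Tgt D e))"
    "Src D e \<in> Vert D" "Tgt D e \<in> Vert D" if e: "e \<in> Edge D" for e
  proof -
    obtain i j where ij: "i \<in> I" "j \<in> I" "i \<noteq> j" and "e = Proj1 i j \<or> e = Proj2 i j"
      using e by (cases e) (auto simp: D(2))
    then show "EArr D e \<in> hom C (VObj D (Src D e)) (VObj D (Tgt D e))"
      "Src D e \<in> Vert D" "Tgt D e \<in> Vert D"
      using pullbackD(3,4,6-8)[OF D(6)[OF ij]]
      by (auto simp: hom_def D(1,3,4) D(5)[OF ij(1)] D(5)[OF ij(2)] D(7)[OF ij])
  qed
  \<comment> \<open>The given pullbacks are kept at the \<open>Single\<close> vertices; at the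
    \<open>Meet\<close> vertices some pullback exists because the legs are in
    \<open>M\<close>.\<close>
  have "\<forall>v\<in>Vert D. \<exists>p' q'. pullback C f (c v) p' q' \<and>
      (\<forall>i. v = Single i \<longrightarrow> p' = p i \<and> q' = q i)"
  proof
    fix v assume v: "v \<in> Vert D"
    show "\<exists>p' q'. pullback C f (c v) p' q' \<and> (\<forall>i. v = Single i \<longrightarrow> p' = p i \<and> q' = q i)"
    proof (cases v)
      case (Single i)
      then show ?thesis using v pq by (auto simp: D(1))
    next
      case Meet
      then show ?thesis using leg_in_M[OF fam sh col k kc v] pullback_obtain f by (metis matching_vertex.distinct(1))
    qed
  qed
  then obtain P' Q where PQ: "\<And>v. v \<in> Vert D \<Longrightarrow> pullback C f (c v) (P' v) (Q v)"
    "\<And>i. Single i \<in> Vert D \<Longrightarrow> P' (Single i) = p i \<and> Q (Single i) = q i"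
    by metis
  \<comment> \<open>The connecting map of an edge is induced by the pullback at its target.\<close>
  have "\<exists>t. t \<in> hom C (Dom C (P' (Src D e))) (Dom C (P' (Tgt D e)))
       \<and> P' (Tgt D e) \<cdot> t = P' (Src D e) \<and> Q (Tgt D e) \<cdot> t = EArr D e \<cdot> Q (Src D e)"
    if e: "e \<in> Edge D" for e
  proof -
    note s = pullbackD[OF PQ(1)[OF E(2)[OF e]]] and g = pullbackD[OF PQ(1)[OF E(3)[OF e]]]
      and ee = homD[OF E(1)[OF e]] homD[OF col_hom[OF E(2)[OF e]]] homD[OF col_hom[OF E(3)[OF e]]]
    have "c (Tgt D e) \<cdot> (EArr D e \<cdot> Q (Src D e)) = c (Src D e) \<cdot> Q (Src D e)"
      by (rule comp_eq_right[OF bspec[OF coc e]]) (use s(1-8) ee in simp_all)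
    then have "f \<cdot> P' (Src D e) = c (Tgt D e) \<cdot> (EArr D e \<cdot> Q (Src D e))"
      using s(9) by simp
    then obtain u where "u \<in> Arr C" "Dom C u = Dom C (EArr D e \<cdot> Q (Src D e))"
      "Cod C u = Dom C (P' (Tgt D e))" "P' (Tgt D e) \<cdot> u = P' (Src D e)"
      "Q (Tgt D e) \<cdot> u = EArr D e \<cdot> Q (Src D e)"
      by (rule pullback_ex[OF PQ(1)[OF E(3)[OF e]], rotated 5]) (use s(1-8) ee in simp_all)
    then show ?thesis using s(1-8) ee by (intro exI[of _ u]) (simp add: hom_def)
  qed
  then obtain t where t: "\<forall>e\<in>Edge D. t e \<in> hom C (Dom C (P' (Src D e))) (Dom C (P' (Tgt D e)))
       \<and> P' (Tgt D e) \<cdot> t e = P' (Src D e) \<and> Q (Tgt D e) \<cdot> t e = EArr D e \<cdot> Q (Src D e)"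
    by metis
  have pulled: "subobject_family C M (Dom C f) I (\<lambda>i. P' (Single i))"
    "matching_shape C I (\<lambda>i. P' (Single i)) (D\<lparr>VObj := \<lambda>v. Dom C (P' v), EArr := t\<rparr>)"
    using pullback_of_matching_shape[OF fam sh col k kc f PQ(1) bspec[OF t]] by blast+
  have "colimit C (D\<lparr>VObj := \<lambda>v. Dom C (P' v), EArr := t\<rparr>) (Dom C f) P'"
    using stable[unfolded stable_under_pullback_def, rule_format, OF f, THEN conjunct2, rule_format,
      of P' Q t] PQ(1) t by blast
  then have "gluing C I (\<lambda>i. P' (Single i)) (Dom C f) (\<lambda>i. P' (Single i))"
    using colimit_iff[OF pulled] by simp
  moreover have "\<And>i. i \<in> I \<Longrightarrow> P' (Single i) = p i" using PQ(2) by (simp add: D)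
  ultimately show ?thesis
    unfolding gluing_def matching_def by (simp cong: ball_cong)
qed

subsection \<open>Joins from colimits\<close>

lemma compatible_span_family:
  assumes "\<And>i. i \<in> I \<Longrightarrow> partial_map A B (m i) (f i)"
  shows "compatible_set P R ((\<lambda>i. span (m i) (f i)) ` I) \<longleftrightarrow> matching C I m f"
proof
  assume comp: "compatible_set P R ((\<lambda>i. span (m i) (f i)) ` I)"
  show "matching C I m f"
    unfolding matching_def
  proof (intro ballI allI impI)
    fix i j p q assume ij: "i \<in> I" "j \<in> I" and pq: "pullback C (m i) (m j) p q"
    then show "f i \<cdot> p = f j \<cdot> q"
      using comp compatible_span[OF assms assms pq] by (auto simp: compatible_set_def)
  qed
next
  assume mat: "matching C I m f"
  have "compatible P R (span (m i) (f i)) (span (m j) (f j))" if ij: "i \<in> I" "j \<in> I" for i j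
  proof -
    note d = partial_mapD[OF assms[OF ij(1)]] and e = partial_mapD[OF assms[OF ij(2)]]
    obtain p q where pq: "pullback C (m i) (m j) p q"
      using pullback_obtain[OF e(1) d(2)] d(5) e(5) by metis
    then show ?thesis
      using compatible_span[OF assms[OF ij(1)] assms[OF ij(2)] pq] matchingD[OF mat ij pq] by simp
  qed
  then show "compatible_set P R ((\<lambda>i. span (m i) (f i)) ` I)"
    by (auto simp: compatible_set_def)
qed

text \<open>An upper bound \<open>(n, g)\<close> amounts to factorisations \<open>u i\<close> of the
  \<open>mi i\<close> through \<open>n\<close>. They match because \<open>n\<close> is monic, hence
  glue to some \<open>w\<close>, and joint epicness of the legs gives \<open>n \<cdot> w = m\<close>
  and \<open>g \<cdot> w = f\<close>.\<close>

lemma is_join_gluing: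
  assumes mf: "partial_map A B m f" and mfi: "\<And>i. i \<in> I \<Longrightarrow> partial_map A B (mi i) (fi i)"
    and gl: "gluing C I mi (Dom C m) c"
    and c: "\<And>i. i \<in> I \<Longrightarrow> m \<cdot> c i = mi i" "\<And>i. i \<in> I \<Longrightarrow> f \<cdot> c i = fi i"
  shows "is_join P R A B ((\<lambda>i. span (mi i) (fi i)) ` I) (span m f)"
  unfolding is_join_def
proof (intro conjI ballI impI)
  show "span m f \<in> hom P A B" using mf by (rule span_hom)
next
  fix s assume "s \<in> (\<lambda>i. span (mi i) (fi i)) ` I"
  then obtain i where i: "i \<in> I" "s = span (mi i) (fi i)" by blast
  then show "restr_le P R s (span m f)"
    using restr_le_span[OF mfi[OF i(1)] mf] gluingD(2)[OF gl i(1)] c[OF i(1)] by blast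
next
  fix K assume K: "K \<in> hom P A B" and ub: "\<forall>s\<in>(\<lambda>i. span (mi i) (fi i)) ` I. restr_le P R s K"
  obtain n g where ng: "partial_map A B n g" "K = span n g"
    using K by (rule Par_homE)
  note d = partial_mapD[OF mf] and e = partial_mapD[OF ng(1)]
  have "\<forall>i\<in>I. \<exists>u \<in> hom C (Dom C (mi i)) (Dom C n). n \<cdot> u = mi i \<and> g \<cdot> u = fi i"
    using ub restr_le_span[OF mfi ng(1)] ng(2) by auto
  then obtain u where u: "\<And>i. i \<in> I \<Longrightarrow> u i \<in> hom C (Dom C (mi i)) (Dom C n)"
    "\<And>i. i \<in> I \<Longrightarrow> n \<cdot> u i = mi i" "\<And>i. i \<in> I \<Longrightarrow> g \<cdot> u i = fi i"
    by metis
  obtain w where w: "w \<in> hom C (Dom C m) (Dom C n)" "\<And>i. i \<in> I \<Longrightarrow> w \<cdot> c i = u i"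
    using gluing_ex[OF gl Dom_Obj[OF e(2)] u(1) matching_factor[OF e(1) u(1,2)]] by metis
  note W = homD[OF w(1)]
  have "n \<cdot> w = m"
  proof (rule gluing_unique[OF gl])
    fix i assume i: "i \<in> I"
    show "(n \<cdot> w) \<cdot> c i = m \<cdot> c i"
      using w(2)[OF i] u(2)[OF i] c[OF i] W e homD[OF gluingD(2)[OF gl i]] by simp
  qed (use W d e in \<open>auto simp: hom_def\<close>)
  moreover have "g \<cdot> w = f"
  proof (rule gluing_unique[OF gl])
    fix i assume i: "i \<in> I"
    show "(g \<cdot> w) \<cdot> c i = f \<cdot> c i"
      using w(2)[OF i] u(3)[OF i] c[OF i] W e homD[OF gluingD(2)[OF gl i]] by simp
  qed (use W d e in \<open>auto simp: hom_def\<close>)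
  ultimately show "restr_le P R (span m f) K"
    using restr_le_span[OF mf ng(1)] w(1) ng(2) by blast
qed

text \<open>Composing with the monic \<open>n\<close> changes neither the domains nor the pullbacks
  of the family, and a gluing depends on nothing else.\<close>

lemma gluing_comp_M:
  assumes "n \<in> M" "\<And>i. i \<in> I \<Longrightarrow> p i \<in> Arr C" "\<And>i. i \<in> I \<Longrightarrow> Cod C (p i) = Dom C n"
  shows "gluing C I (\<lambda>i. n \<cdot> p i) U c \<longleftrightarrow> gluing C I p U c"
proof -
  have "matching C I (\<lambda>i. n \<cdot> p i) d \<longleftrightarrow> matching C I p d" for d
    unfolding matching_def using assms pullback_monic_comp[OF M_monic[OF assms(1)]] by simp
  moreover have "Dom C (n \<cdot> p i) = Dom C (p i)" if "i \<in> I" for i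
    using that assms by simp
  ultimately show ?thesis unfolding gluing_def by (simp cong: ball_cong)
qed

text \<open>Compatible partial maps with the same domain of definition are equal, so a compatible set is
  no larger than the set of subobjects.\<close>

lemma compatible_set_indexed:
  assumes small: "locally_small TYPE('i) C M" and A: "A \<in> Obj C"
    and S: "S \<subseteq> hom P A B" "compatible_set P R S"
  obtains I :: "'i set" and m f where "\<And>i. i \<in> I \<Longrightarrow> partial_map A B (m i) (f i)"
    "S = (\<lambda>i. span (m i) (f i)) ` I"
proof -
  obtain e :: "'a set \<Rightarrow> 'i" where e: "inj_on e (subobjects C M A)"
    using small A unfolding locally_small_def by blast
  have fst_span: "fst ` span m f = subobject_class C m" for m f
    by (force simp: span_class_def subobject_class_def image_iff)
  have inj: "inj_on (\<lambda>F. e (fst ` F)) S"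
  proof (rule inj_onI)
    fix F G assume FG: "F \<in> S" "G \<in> S" "e (fst ` F) = e (fst ` G)"
    obtain m f where mf: "partial_map A B m f" "F = span m f"
      using Par_homE S(1) FG(1) by blast
    obtain n g where ng: "partial_map A B n g" "G = span n g"
      using Par_homE S(1) FG(2) by blast
    note d = partial_mapD[OF mf(1)] and d' = partial_mapD[OF ng(1)]
    have "subobject_class C m \<in> subobjects C M A" "subobject_class C n \<in> subobjects C M A"
      using d d' by (auto simp: subobjects_def)
    then have "subobject_class C m = subobject_class C n"
      using FG(3) e mf ng by (simp add: fst_span inj_on_eq_iff)
    moreover have "n \<in> subobject_class C n"
      using fst_span[of n g] span_self[OF ng(1)] by force
    ultimately obtain i where i: "iso C i" "Cod C i = Dom C m" "n = m \<cdot> i"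
      by (auto simp: subobject_class_def)
    \<comment> \<open>The subobjects agree, so their intersection is \<open>n = m \<cdot> i\<close>
      itself, and compatibility reads \<open>f \<cdot> i = g\<close>.\<close>
    have "pullback C m n i (Ident C (Dom C i))"
      unfolding i(3)
      by (rule pullback_swap, rule pullback_along_factor) (use i iso_Arr d M_monic in auto)
    then have "f \<cdot> i = g \<cdot> Ident C (Dom C i)"
      using compatible_span[OF mf(1) ng(1)] S(2) FG mf(2) ng(2) by (simp add: compatible_set_def)
    moreover have "Dom C g = Dom C i"
      using d' i(2,3) d iso_Arr[OF i(1)] by simp
    ultimately have "g = f \<cdot> i" using d' by simp
    then show "F = G"
      using span_eq_iff[OF mf(1) ng(1)] i mf(2) ng(2) by auto
  qed
  \<comment> \<open>The indices are the codes in \<open>'i\<close> of the underlying subobjects, and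
    \<open>h\<close> decodes them.\<close>
  define I where "I = (\<lambda>F. e (fst ` F)) ` S"
  define h where "h = inv_into S (\<lambda>F. e (fst ` F))"
  have h: "h ` I = S"
    unfolding I_def h_def using inv_into_image_cancel[OF inj subset_refl] .
  have "\<exists>m f. partial_map A B m f \<and> h i = span m f" if "i \<in> I" for i
  proof -
    have "h i \<in> hom P A B" using h S(1) that by blast
    then show ?thesis by (rule Par_homE) blast
  qed
  then obtain m f where mf: "\<And>i. i \<in> I \<Longrightarrow> partial_map A B (m i) (f i)"
    "\<And>i. i \<in> I \<Longrightarrow> h i = span (m i) (f i)"
    by metis
  have "S = (\<lambda>i. span (m i) (f i)) ` I"
    using h mf(2) by force
  with mf(1) that show ?thesis by blast
qed

lemma geometric_if_colimits:
  assumes small: "locally_small TYPE('i) C M"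
    and ex: "\<And>A (I :: 'i set) m. subobject_family C M A I m \<Longrightarrow>
      \<exists>U c. colimit C (matching_diagram C I m) U c"
    and inM: "\<And>A (I :: 'i set) m U c. \<lbrakk>subobject_family C M A I m;
      colimit C (matching_diagram C I m) U c\<rbrakk> \<Longrightarrow> join_map C A I m U c \<in> M"
    and stable: "\<And>A (I :: 'i set) m U c. \<lbrakk>subobject_family C M A I m;
      colimit C (matching_diagram C I m) U c\<rbrakk> \<Longrightarrow>
      stable_under_pullback C (matching_diagram C I m) U c"
  shows "geometric C M"
proof -
  interpret Par: restriction_category P R by (rule Par_restriction_category)
  \<comment> \<open>\<open>J1\<close> and \<open>J2\<close> concern every join, but it is enough to
    verify them for one constructed join, since joins are unique.\<close>
  have join: "\<exists>F. is_join P R A B S F \<and> is_join P R A A (R ` S) (R F) \<and>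
      (\<forall>D G. G \<in> hom P D A \<longrightarrow>
         is_join P R D B ((\<lambda>s. s \<cdot>\<^bsub>P\<^esub> G) ` S) (F \<cdot>\<^bsub>P\<^esub> G))"
    if AB: "A \<in> Obj C" "B \<in> Obj C" and S: "S \<subseteq> hom P A B" "compatible_set P R S" for A B S
  proof -
    obtain I :: "'i set" and m f where mf: "\<And>i. i \<in> I \<Longrightarrow> partial_map A B (m i) (f i)"
      and SI: "S = (\<lambda>i. span (m i) (f i)) ` I"
      using compatible_set_indexed[OF small AB(1) S] by blast
    have fam: "subobject_family C M A I m"
      using AB partial_mapD[OF mf] by (auto simp: subobject_family_def)
    obtain U c' where col: "colimit C (matching_diagram C I m) U c'"
      using ex[OF fam] by blast
    define k where "k = join_map C A I m U c'"
    define c where "c = (\<lambda>i. c' (Single i))"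
    note shape = matching_shape_diagram[OF fam]
    have k: "k \<in> M" "k \<in> hom C U A" "\<And>i. i \<in> I \<Longrightarrow> k \<cdot> c i = m i"
      using inM[OF fam col] join_map_hom[OF fam col] by (simp_all add: k_def c_def)
    note K = homD[OF k(2)]
    have gl: "gluing C I m U c"
      using col colimit_iff[OF fam shape] by (simp add: c_def)
    \<comment> \<open>Compatibility lets the \<open>f i\<close> glue to \<open>g\<close> on
      \<open>U\<close>; the join is then the span of \<open>k\<close> and \<open>g\<close>.\<close>
    have "matching C I m f"
      using S(2) compatible_span_family[of I A B m f] mf by (simp add: SI)
    then obtain g where g: "g \<in> hom C U B" "\<And>i. i \<in> I \<Longrightarrow> g \<cdot> c i = f i"
      using gluing_ex[OF gl AB(2), of f] mf by (auto simp: partial_map_def hom_def)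
    have kg: "partial_map A B k g"
      using k g by (auto simp: partial_map_def hom_def)
    have J: "is_join P R A B S (span k g)"
      unfolding SI by (rule is_join_gluing[OF kg mf, where c = c]) (use gl K k g in auto)
    have RS: "R ` S = (\<lambda>i. span (m i) (m i)) ` I"
      unfolding SI image_image by (rule image_cong) (auto simp: par_restriction_span[OF mf])
    have J1: "is_join P R A A (R ` S) (R (span k g))"
      unfolding RS par_restriction_span[OF kg]
      by (rule is_join_gluing[OF partial_map_restriction[OF kg] partial_map_restriction[OF mf], where c = c])
        (use gl K k in auto)
    have J2: "is_join P R D B ((\<lambda>s. s \<cdot>\<^bsub>P\<^esub> G) ` S) (span k g \<cdot>\<^bsub>P\<^esub> G)"
      if G: "G \<in> hom P D A" for D G
    proof -
      obtain l h where lh: "partial_map D A l h" "G = span l h"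
        using G by (rule Par_homE)
      note L = partial_mapD[OF lh(1)]
      obtain p q where pq: "pullback C h k p q" "partial_map D B (l \<cdot> p) (g \<cdot> q)"
        "par_comp C (span k g) (span l h) = span (l \<cdot> p) (g \<cdot> q)"
        using lh(1) kg by (rule Par_comp_obtain)
      note H = pullbackD[OF pq(1)]
      have q: "Cod C q = U" using H K by simp
      have "\<exists>p' q'. pullback C q (c i) p' q'" if i: "i \<in> I" for i
        using stable[OF fam col, unfolded stable_under_pullback_def, rule_format, OF H(4) q] i
        by (simp add: ball_matching_vertex c_def)
      then obtain p' q' where pq': "\<And>i. i \<in> I \<Longrightarrow> pullback C q (c i) (p' i) (q' i)"
        by metis
      \<comment> \<open>The composite with \<open>G\<close> is defined on the pullback of
        \<open>k\<close> along \<open>h\<close>, whose other projection \<open>q\<close> maps into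
        \<open>U\<close>. Stability along \<open>q\<close> presents this domain as a gluing of the
        pulled back legs.\<close>
      have gl': "gluing C I p' (Dom C q) p'"
        by (rule stable_under_pullbackD[OF fam shape col k(1,2) _ stable[OF fam col] H(4) q])
          (use pq' k(3) in \<open>auto simp: c_def\<close>)
      \<comment> \<open>Pasting identifies \<open>p \<cdot> p' i\<close> as the pullback of
        \<open>m i = k \<cdot> c i\<close> along \<open>h\<close>, so
        \<open>l \<cdot> (p \<cdot> p' i)\<close> is the domain of the composite of \<open>G\<close>
        with the partial map \<open>(m i, f i)\<close>.\<close>
      have props: "pullback C h (m i) (p \<cdot> p' i) (q' i)"
        "p' i \<in> Arr C" "Cod C (p' i) = Dom C p"
        "f i \<cdot> q' i = (g \<cdot> q) \<cdot> p' i" if i: "i \<in> I" for i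
      proof -
        note H' = pullbackD[OF pq'[OF i]] and ci = homD[OF gluingD(2)[OF gl i]]
        show "pullback C h (m i) (p \<cdot> p' i) (q' i)"
          using pullback_paste[OF pq(1) pq'[OF i]] k(3)[OF i] by simp
        show "p' i \<in> Arr C" "Cod C (p' i) = Dom C p" using H' H by simp_all
        have "g \<cdot> (c i \<cdot> q' i) = f i \<cdot> q' i"
          by (rule comp_eq_right[OF g(2)[OF i]]) (use homD[OF g(1)] H' ci in simp_all)
        then show "f i \<cdot> q' i = (g \<cdot> q) \<cdot> p' i"
          using H'(9) homD[OF g(1)] H'(1-8) q by simp
      qed
      have lp: "(l \<cdot> p) \<cdot> p' i = l \<cdot> (p \<cdot> p' i)" if "i \<in> I" for i
        using props[OF that] H L by simp
      have pm: "partial_map D B ((l \<cdot> p) \<cdot> p' i) (f i \<cdot> q' i)"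
        and comp: "span (m i) (f i) \<cdot>\<^bsub>P\<^esub> G = span ((l \<cdot> p) \<cdot> p' i) (f i \<cdot> q' i)"
        if i: "i \<in> I" for i
        using partial_map_comp[OF lh(1) mf[OF i] props(1)[OF i]]
          par_comp_span[OF lh(1) mf[OF i] props(1)[OF i]] lh(2) lp[OF i] by simp_all
      have img: "(\<lambda>s. s \<cdot>\<^bsub>P\<^esub> G) ` S = (\<lambda>i. span ((l \<cdot> p) \<cdot> p' i) (f i \<cdot> q' i)) ` I"
        unfolding SI image_image by (rule image_cong) (use comp in auto)
      have Dlp: "Dom C (l \<cdot> p) = Dom C p" using H L by simp
      have gl2: "gluing C I (\<lambda>i. (l \<cdot> p) \<cdot> p' i) (Dom C (l \<cdot> p)) p'"
        using gl' gluing_comp_M[OF partial_mapD(1)[OF pq(2)], of I p'] props(2,3) Dlp H(8) by simp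
      have "is_join P R D B ((\<lambda>i. span ((l \<cdot> p) \<cdot> p' i) (f i \<cdot> q' i)) ` I) (span (l \<cdot> p) (g \<cdot> q))"
        by (rule is_join_gluing[OF pq(2) pm gl2]) (use props(4) in auto)
      then show ?thesis using pq(3) lh(2) img by simp
    qed
    show ?thesis using J J1 J2 by blast
  qed
  \<comment> \<open>\<open>J1\<close> and \<open>J2\<close> do not state that \<open>A\<close> and
    \<open>B\<close> are objects; a join in the hom-set provides this.\<close>
  have AB: "A \<in> Obj C \<and> B \<in> Obj C" if "is_join P R A B S F" for A B S F
    using that Par_homE[of F A B] partial_mapD(7,8) unfolding is_join_def by metis
  show ?thesis
    unfolding geometric_def
  proof
    fix A B S assume "A \<in> Obj P" "B \<in> Obj P" "S \<subseteq> hom P A B" "compatible_set P R S"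
    then show "\<exists>j. is_join P R A B S j" using join[of A B S] by auto
  next
    fix A B S F assume a: "S \<subseteq> hom P A B" "compatible_set P R S" "is_join P R A B S F"
    then obtain F' where F': "is_join P R A B S F'" "is_join P R A A (R ` S) (R F')"
      using join[of A B S] AB[OF a(3)] by blast
    then show "is_join P R A A (R ` S) (R F)" using is_join_unique[OF a(3) F'(1)] by simp
  next
    fix A B S F D G assume a: "S \<subseteq> hom P A B" "compatible_set P R S" "is_join P R A B S F"
      "G \<in> hom P D A"
    then obtain F' where F': "is_join P R A B S F'"
      "is_join P R D B ((\<lambda>s. s \<cdot>\<^bsub>P\<^esub> G) ` S) (F' \<cdot>\<^bsub>P\<^esub> G)"
      using join[of A B S] AB[OF a(3)] by blast
    then show "is_join P R D B ((\<lambda>s. s \<cdot>\<^bsub>P\<^esub> G) ` S) (F \<cdot>\<^bsub>P\<^esub> G)"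
      using is_join_unique[OF a(3) F'(1)] by simp
  qed
qed

subsection \<open>Colimits from joins\<close>

lemma partial_map_family:
  "\<lbrakk>subobject_family C M A I m; i \<in> I\<rbrakk> \<Longrightarrow> partial_map A A (m i) (m i)"
  using subobject_familyD by (auto intro!: partial_mapI)

lemma geometric_join_idempotents:
  assumes geo: "geometric C M" and fam: "subobject_family C M A I m"
  obtains n where "partial_map A A n n"
    "is_join P R A A ((\<lambda>i. span (m i) (m i)) ` I) (span n n)"
proof -
  interpret J: join_restriction_category P R using geo by (simp add: geometric_def)
  let ?S = "(\<lambda>i. span (m i) (m i)) ` I"
  note pm = partial_map_family[OF fam]
  have S: "?S \<subseteq> hom P A A" using span_hom[OF pm] by blast
  have comp: "compatible_set P R ?S"
    using compatible_span_family[of I A A m m] pm matching_self by blast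
  have A: "A \<in> Obj P" using fam by (simp add: subobject_family_def)
  obtain F where F: "is_join P R A A ?S F" using J.join_exists[OF A A S comp] by blast
  then obtain n f where nf: "partial_map A A n f" "F = span n f"
    using Par_homE unfolding is_join_def by metis
  \<comment> \<open>The idempotents are their own restrictions, so by \<open>J1\<close> the
    restriction of their join is again their join.\<close>
  have "R ` ?S = ?S"
    unfolding image_image by (rule image_cong) (auto simp: par_restriction_span[OF pm])
  then have "is_join P R A A ?S (span n n)"
    using J.J1[OF S comp F] nf(2) par_restriction_span[OF nf(1)] by simp
  with partial_map_restriction[OF nf(1)] that show ?thesis by blast
qed

text \<open>A matching family \<open>d\<close> is a compatible set of partial maps
  \<open>(m i, d i)\<close>. By \<open>J1\<close> their join is defined on all of \<open>n\<close>,
  which makes it an arrow from \<open>Dom C n\<close> extending \<open>d\<close>; leastness of the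
  join gives uniqueness.\<close>

lemma geometric_gluing:
  assumes geo: "geometric C M" and fam: "subobject_family C M A I m"
    and n: "partial_map A A n n" and join: "is_join P R A A ((\<lambda>i. span (m i) (m i)) ` I) (span n n)"
  shows "\<exists>c. gluing C I m (Dom C n) c \<and> (\<forall>i\<in>I. n \<cdot> c i = m i)"
proof -
  interpret J: join_restriction_category P R using geo by (simp add: geometric_def)
  note pm = partial_map_family[OF fam] and N = partial_mapD[OF n]
  have "\<forall>i\<in>I. \<exists>u \<in> hom C (Dom C (m i)) (Dom C n). n \<cdot> u = m i"
    using join restr_le_span[OF pm n] unfolding is_join_def by auto
  then obtain c where c: "\<And>i. i \<in> I \<Longrightarrow> c i \<in> hom C (Dom C (m i)) (Dom C n)"
    "\<And>i. i \<in> I \<Longrightarrow> n \<cdot> c i = m i"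
    by metis
  \<comment> \<open>The factorisation of \<open>m i\<close> through the monic \<open>n\<close> is
    unique, so \<open>c i\<close> is the only candidate witness for the order.\<close>
  have above: "restr_le P R (span (m i) (d i)) (span n e) \<longleftrightarrow> e \<cdot> c i = d i"
    if i: "i \<in> I" and d: "d i \<in> hom C (Dom C (m i)) Y" and e: "e \<in> hom C (Dom C n) Y" for i d e Y
  proof -
    have pms: "partial_map A Y (m i) (d i)" "partial_map A Y n e"
      using subobject_familyD[OF fam i] homD[OF d] homD[OF e] N by (auto intro!: partial_mapI)
    have "u = c i" if "u \<in> hom C (Dom C (m i)) (Dom C n)" "n \<cdot> u = m i" for u
      by (rule M_eq[OF _ N(1)])
        (use homD[OF that(1)] that(2) homD[OF c(1)[OF i]] c(2)[OF i] in simp_all)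
    then show ?thesis unfolding restr_le_span[OF pms] using c[OF i] by blast
  qed
  have "\<exists>!e. e \<in> hom C (Dom C n) Y \<and> (\<forall>i\<in>I. e \<cdot> c i = d i)"
    if Y: "Y \<in> Obj C" and d: "\<forall>i\<in>I. d i \<in> hom C (Dom C (m i)) Y" and mat: "matching C I m d" for Y d
  proof -
    let ?S = "(\<lambda>i. span (m i) (d i)) ` I"
    have pmd: "partial_map A Y (m i) (d i)" if "i \<in> I" for i
      using subobject_familyD[OF fam that] d that by (auto simp: hom_def intro!: partial_mapI)
    have S: "?S \<subseteq> hom P A Y" using span_hom[OF pmd] by blast
    have comp: "compatible_set P R ?S"
      using compatible_span_family[of I A Y m d] pmd mat by blast
    have A: "A \<in> Obj P" "Y \<in> Obj P" using Y N by simp_all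
    obtain F where F: "is_join P R A Y ?S F" using J.join_exists[OF A S comp] by blast
    then obtain n' d' where nd: "partial_map A Y n' d'" "F = span n' d'"
      using Par_homE unfolding is_join_def by metis
    note N' = partial_mapD[OF nd(1)]
    have "R ` ?S = (\<lambda>i. span (m i) (m i)) ` I"
      unfolding image_image by (rule image_cong) (auto simp: par_restriction_span[OF pmd])
    then have "is_join P R A A ((\<lambda>i. span (m i) (m i)) ` I) (span n' n')"
      using J.J1[OF S comp F] nd(2) par_restriction_span[OF nd(1)] by simp
    then have "span n' n' = span n n"
      using join by (rule is_join_unique)
    then obtain i where i: "iso C i" "Cod C i = Dom C n" "n' = n \<cdot> i"
      using span_eq_iff[OF n partial_map_restriction[OF nd(1)]] by blast
    obtain j where j: "i \<in> Arr C" "j \<in> Arr C" "Dom C j = Cod C i" "Cod C j = Dom C i"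
      "j \<cdot> i = Ident C (Dom C i)"
      using i(1) by (rule isoE)
    have di: "Dom C d' = Dom C i" using N' i N j by simp
    \<comment> \<open>Reparametrising along the inverse of \<open>i\<close> represents the join by a
      span whose first leg is \<open>n\<close> itself.\<close>
    define e where "e = d' \<cdot> j"
    have e: "e \<in> hom C (Dom C n) Y" using j i N' di by (simp add: e_def hom_def)
    have ei: "e \<cdot> i = d'" using j i N' di by (simp add: e_def)
    have pme: "partial_map A Y n x" if "x \<in> hom C (Dom C n) Y" for x
      using N homD[OF that] by (auto intro!: partial_mapI)
    have Fe: "F = span n e"
      unfolding nd(2) span_eq_iff[OF pme[OF e] nd(1)] using i ei by blast
    show ?thesis
    proof (rule ex1I)
      show "e \<in> hom C (Dom C n) Y \<and> (\<forall>i\<in>I. e \<cdot> c i = d i)"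
        using F e above d unfolding is_join_def Fe by blast
    next
      fix x assume x: "x \<in> hom C (Dom C n) Y \<and> (\<forall>i\<in>I. x \<cdot> c i = d i)"
      then have "\<forall>s\<in>?S. restr_le P R s (span n x)" using above d by blast
      \<comment> \<open>Any other mediating arrow \<open>x\<close> is an upper bound with the same
        domain \<open>n\<close>; the comparison \<open>u\<close> fixes the monic \<open>n\<close>
        and is therefore the identity.\<close>
      then have "restr_le P R (span n e) (span n x)"
        using F x span_hom[OF pme] unfolding is_join_def Fe by blast
      then obtain u where u: "u \<in> hom C (Dom C n) (Dom C n)" "n \<cdot> u = n" "x \<cdot> u = e"
        using restr_le_span[OF pme pme] e x by blast
      have "u = Ident C (Dom C n)"
        by (rule M_eq[OF _ N(1)]) (use homD[OF u(1)] u(2) N in simp_all)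
      then show "x = e" using u(3) x by (simp add: hom_def)
    qed
  qed
  then have "gluing C I m (Dom C n) c"
    unfolding gluing_def using c N matching_factor[OF N(1) c] by simp
  with c show ?thesis by blast
qed

lemma geometric_colimit:
  assumes "geometric C M" "subobject_family C M A I m"
  shows "\<exists>U c. colimit C (matching_diagram C I m) U c"
proof -
  obtain n where n: "partial_map A A n n" "is_join P R A A ((\<lambda>i. span (m i) (m i)) ` I) (span n n)"
    using assms by (rule geometric_join_idempotents)
  obtain c where c: "gluing C I m (Dom C n) c"
    using geometric_gluing[OF assms n] by blast
  define c' where "c' v = (case v of Single i \<Rightarrow> c i
      | Meet i j \<Rightarrow> c i \<cdot> EArr (matching_diagram C I m) (Proj1 i j))" for v
  have "colimit C (matching_diagram C I m) (Dom C n) c'"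
    unfolding colimit_iff[OF assms(2) matching_shape_diagram[OF assms(2)]] using c by (simp add: c'_def)
  then show ?thesis by blast
qed

text \<open>Any colimit is isomorphic to the gluing built on the join \<open>n\<close> of the
  idempotents, and under this isomorphism \<open>join_map\<close> corresponds to
  \<open>n\<close>.\<close>

lemma geometric_join_map:
  assumes geo: "geometric C M" and fam: "subobject_family C M A I m"
    and col: "colimit C (matching_diagram C I m) U c"
  shows "join_map C A I m U c \<in> M"
    "is_join P R A A ((\<lambda>i. span (m i) (m i)) ` I) (span (join_map C A I m U c) (join_map C A I m U c))"
proof -
  let ?k = "join_map C A I m U c"
  obtain n where n: "partial_map A A n n" "is_join P R A A ((\<lambda>i. span (m i) (m i)) ` I) (span n n)"
    using geo fam by (rule geometric_join_idempotents)
  obtain d where d: "gluing C I m (Dom C n) d" "\<And>i. i \<in> I \<Longrightarrow> n \<cdot> d i = m i"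
    using geometric_gluing[OF geo fam n] by blast
  have gl: "gluing C I m U (\<lambda>i. c (Single i))"
    using col colimit_iff[OF fam matching_shape_diagram[OF fam]] by simp
  obtain w where w: "iso C w" "w \<in> hom C U (Dom C n)" "\<And>i. i \<in> I \<Longrightarrow> w \<cdot> c (Single i) = d i"
    using gluing_iso[OF gl d(1)] by metis
  note N = partial_mapD[OF n(1)] and W = homD[OF w(2)] and k = join_map_hom[OF fam col]
  have kn: "?k = n \<cdot> w"
  proof (rule gluing_unique[OF gl k(1)])
    show "n \<cdot> w \<in> hom C U A" using N W by (simp add: hom_def)
    fix i assume i: "i \<in> I"
    show "?k \<cdot> c (Single i) = (n \<cdot> w) \<cdot> c (Single i)"
      using k(2)[OF i] w(3)[OF i] d(2)[OF i] N W homD[OF gluingD(2)[OF gl i]] by simp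
  qed
  then show kM: "?k \<in> M" using M_Comp[OF N(1) M_iso[OF w(1)]] W by simp
  have "span ?k ?k = span n n"
    using span_member(2)[OF n(1)] w(1) W kn by (auto simp: span_iff[OF n(1)])
  with n(2) show "is_join P R A A ((\<lambda>i. span (m i) (m i)) ` I) (span ?k ?k)" by simp
qed

lemma geometric_stable:
  assumes geo: "geometric C M" and fam: "subobject_family C M A I m"
    and col: "colimit C (matching_diagram C I m) U c"
  shows "stable_under_pullback C (matching_diagram C I m) U c"
proof (rule stable_under_pullbackI[OF fam matching_shape_diagram[OF fam] col
      geometric_join_map(1)[OF geo fam col] join_map_hom[OF fam col]])
  interpret J: join_restriction_category P R using geo by (simp add: geometric_def)
  let ?k = "join_map C A I m U c" and ?S = "(\<lambda>i. span (m i) (m i)) ` I"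
  note kM = geometric_join_map(1)[OF geo fam col] and join = geometric_join_map(2)[OF geo fam col]
    and k = join_map_hom[OF fam col]
  note K = homD[OF k(1)]
  have gl: "gluing C I m U (\<lambda>i. c (Single i))"
    using col colimit_iff[OF fam matching_shape_diagram[OF fam]] by simp
  note pm = partial_map_family[OF fam]
  fix f p q assume f: "f \<in> Arr C" "Cod C f = U"
    and pq: "\<And>i. i \<in> I \<Longrightarrow> pullback C f (c (Single i)) (p i) (q i)"
  define X where "X = Dom C f"
  have X: "X \<in> Obj C" using f by (simp add: X_def)
  have g: "partial_map X A (Ident C X) (?k \<cdot> f)"
    using partial_map_total[of "?k \<cdot> f" X A] f K by (simp add: X_def hom_def)
  have pmk: "partial_map A A ?k ?k" using kM K by (auto intro!: partial_mapI)
  have "pullback C (?k \<cdot> f) ?k (Ident C X) f"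
    unfolding X_def by (rule pullback_along_factor) (use f K kM M_monic in auto)
  \<comment> \<open>\<open>?k \<cdot> f\<close> factors through \<open>?k\<close>, so composing the
    total map with the idempotent of \<open>?k\<close> does not change it.\<close>
  from par_comp_span[OF g pmk this]
  have G: "span ?k ?k \<cdot>\<^bsub>P\<^esub> span (Ident C X) (?k \<cdot> f) = span (Ident C X) (?k \<cdot> f)"
    using X by simp
  have pbm: "pullback C (?k \<cdot> f) (m i) (p i) (q i)" "p i \<in> M" "Cod C (p i) = X" if i: "i \<in> I" for i
  proof -
    have ci: "c (Single i) \<in> hom C (Dom C (m i)) U" using gluingD(2)[OF gl i] .
    have "pullback C (?k \<cdot> f) (?k \<cdot> c (Single i)) (p i) (q i)"
      using pullback_monic_comp[OF M_monic[OF kM]] pq[OF i] homD[OF ci] f K by simp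
    then show pb: "pullback C (?k \<cdot> f) (m i) (p i) (q i)" using k(2)[OF i] by simp
    show "p i \<in> M" using M_pullback_closed[OF _ pb] subobject_familyD(1)[OF fam i] by blast
    show "Cod C (p i) = X" using pullbackD[OF pq[OF i]] by (simp add: X_def)
  qed
  have comp: "par_comp C (span (m i) (m i)) (span (Ident C X) (?k \<cdot> f)) = span (p i) (m i \<cdot> q i)"
    and pmp: "partial_map X A (p i) (m i \<cdot> q i)" if i: "i \<in> I" for i
    using par_comp_span[OF g pm[OF i] pbm(1)[OF i]] partial_map_comp[OF g pm[OF i] pbm(1)[OF i]]
      pbm(2,3)[OF i] by simp_all
  have S: "?S \<subseteq> hom P A A" "compatible_set P R ?S"
    using span_hom[OF pm] compatible_span_family[of I A A m m] pm matching_self by blast+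
  let ?T = "(\<lambda>i. span (p i) (m i \<cdot> q i)) ` I"
  have img: "(\<lambda>s. s \<cdot>\<^bsub>P\<^esub> span (Ident C X) (?k \<cdot> f)) ` ?S = ?T"
    unfolding image_image by (rule image_cong) (use comp in auto)
  have joinT: "is_join P R X A ?T (span (Ident C X) (?k \<cdot> f))"
    \<comment> \<open>By \<open>J2\<close> the total map is the join of its restrictions to the
      pulled back subobjects \<open>p i\<close>.\<close>
    using J.J2[OF S join span_hom[OF g]] unfolding img G .
  have T: "?T \<subseteq> hom P X A" using span_hom[OF pmp] by blast
  have "matching C I p (\<lambda>i. m i \<cdot> q i)"
  proof -
    have eq: "m i \<cdot> q i = (?k \<cdot> f) \<cdot> p i" if "i \<in> I" for i
      using pullbackD(9)[OF pbm(1)[OF that]] by simp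
    have "matching C I p (\<lambda>i. (?k \<cdot> f) \<cdot> p i)"
      by (rule matching_comp[OF matching_self, of _ _ X _ A])
        (use pbm f K in \<open>auto simp: hom_def X_def\<close>)
    then show ?thesis unfolding matching_def using eq by simp
  qed
  then have compT: "compatible_set P R ?T"
    using compatible_span_family[of I X A p "\<lambda>i. m i \<cdot> q i"] pmp by blast
  have RT: "R ` ?T = (\<lambda>i. span (p i) (p i)) ` I"
    unfolding image_image by (rule image_cong) (auto simp: par_restriction_span[OF pmp])
  \<comment> \<open>Taking restrictions with \<open>J1\<close> forgets the values: the subobjects
    \<open>p i\<close> cover \<open>X\<close>. Gluing over this identity join then has the
    \<open>p i\<close> themselves as legs.\<close>
  have joinp: "is_join P R X X ((\<lambda>i. span (p i) (p i)) ` I) (span (Ident C X) (Ident C X))"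
    using J.J1[OF T compT joinT] unfolding RT par_restriction_span[OF g] .
  have famp: "subobject_family C M X I p"
    using pbm X by (simp add: subobject_family_def)
  obtain e where e: "gluing C I p (Dom C (Ident C X)) e"
      "\<And>i. i \<in> I \<Longrightarrow> Ident C X \<cdot> e i = p i"
    using geometric_gluing[OF geo famp partial_map_Ident[OF X] joinp] by blast
  have "e i = p i" if "i \<in> I" for i
    using e(2)[OF that] gluingD(2)[OF e(1) that] X by (simp add: hom_def)
  then show "gluing C I p (Dom C f) p"
    using e(1) X unfolding gluing_def matching_def X_def by (simp cong: ball_cong)
qed

end

theorem theorem11:
  fixes C :: "('o, 'a) cat" and M :: "'a set"
  assumes "M_category C M"
    and "locally_small TYPE('i) C M"
  shows "geometric C M \<longleftrightarrow>
    (\<forall>A (I :: 'i set) m. subobject_family C M A I m \<longrightarrow>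
       (\<exists>U c. colimit C (matching_diagram C I m) U c)) \<and>
    (\<forall>A (I :: 'i set) m U c.
       subobject_family C M A I m \<and> colimit C (matching_diagram C I m) U c \<longrightarrow>
       join_map C A I m U c \<in> M) \<and>
    (\<forall>A (I :: 'i set) m U c.
       subobject_family C M A I m \<and> colimit C (matching_diagram C I m) U c \<longrightarrow>
       stable_under_pullback C (matching_diagram C I m) U c)"
proof -
  interpret M_category C M by (rule assms(1))
  show ?thesis
  proof (intro iffI conjI allI impI; (elim conjE)?)
    fix A and I :: "'i set" and m
    assume "geometric C M" "subobject_family C M A I m"
    then show "\<exists>U c. colimit C (matching_diagram C I m) U c"
      by (rule geometric_colimit)
  next
    fix A and I :: "'i set" and m U c
    assume "geometric C M" "subobject_family C M A I m" "colimit C (matching_diagram C I m) U c"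
    then show "join_map C A I m U c \<in> M" "stable_under_pullback C (matching_diagram C I m) U c"
      by (rule geometric_join_map(1), rule geometric_stable)
  next
    show "geometric C M"
      if "\<forall>A (I :: 'i set) m. subobject_family C M A I m \<longrightarrow>
       (\<exists>U c. colimit C (matching_diagram C I m) U c)"
    "\<forall>A (I :: 'i set) m U c.
       subobject_family C M A I m \<and> colimit C (matching_diagram C I m) U c \<longrightarrow>
       join_map C A I m U c \<in> M"
    "\<forall>A (I :: 'i set) m U c.
       subobject_family C M A I m \<and> colimit C (matching_diagram C I m) U c \<longrightarrow>
       stable_under_pullback C (matching_diagram C I m) U c"
      by (rule geometric_if_colimits[OF assms(2)]) (use that in blast)+
  qed
qed

end
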